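(* Let $D$ be a domain in $\mathbb{C}^n$, let $\mathcal{F}$ be a family of holomorphic functions on $D$, and let $a,b$ be two distinct complex numbers. If for each $f\in\mathcal{F}$ we have $f(z)\neq a$ for all $z\in D$ and, for each $\alpha\in D$ with $f(\alpha)=b$, the zero multiplicity of $f-b$ at $\alpha$ is at least two, then $\mathcal{F}$ is normal in $D$.
   Context: For a holomorphic function $h$ near $p\in\mathbb{C}^n$, write $h(z)=\sum_{i\ge 0}P_i(z-p)$ with each $P_i$ either a homogeneous polynomial of degree $i$ or identically zero; the zero multiplicity of $h$ at $p$ is $\min\{i:P_i\not\equiv 0\}$. A family of holomorphic functions on $D$ is normal in $D$ if every sequence in it has a subsequence converging locally uniformly in $D$.
   Formalization: Normality is taken in Montel's sense: a subsequence may also converge to infinity uniformly on compact subsets of D; with finite limits only, the claim fails for the constant functions f_k = k with k > |a|+|b|. *)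

theory Defs
  imports "HOL-Analysis.Analysis" "HOL-Library.Extended_Nat"
begin

definition holo_on :: "(complex^'n \<Rightarrow> complex) \<Rightarrow> (complex^'n) set \<Rightarrow> bool" where
  "holo_on f D \<longleftrightarrow> (\<forall>z\<in>D. \<exists>c::complex^'n.
      (f has_derivative (\<lambda>v. \<Sum>j\<in>UNIV. c$j * v$j)) (at z))"

definition homog_poly :: "nat \<Rightarrow> (complex^'n \<Rightarrow> complex) \<Rightarrow> bool" where
  "homog_poly i P \<longleftrightarrow> (\<exists>c::('n \<Rightarrow> nat) \<Rightarrow> complex. \<forall>z.
      P z = (\<Sum>\<beta>\<in>{\<beta>. sum \<beta> UNIV = i}. c \<beta> * (\<Prod>j\<in>UNIV. (z$j) ^ \<beta> j)))"

definition homog_expansion ::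
  "(complex^'n \<Rightarrow> complex) \<Rightarrow> complex^'n \<Rightarrow> (nat \<Rightarrow> complex^'n \<Rightarrow> complex) \<Rightarrow> bool" where
  "homog_expansion h p P \<longleftrightarrow> (\<forall>i. homog_poly i (P i)) \<and>
      (\<exists>e>0. \<forall>z\<in>ball p e. (\<lambda>i. P i (z - p)) sums h z)"

text \<open>Zero multiplicity: min{i. P_i not identically 0} (infinity if all vanish);
  well defined by uniqueness of the homogeneous expansion.\<close>
definition zero_mult :: "(complex^'n \<Rightarrow> complex) \<Rightarrow> complex^'n \<Rightarrow> enat" where
  "zero_mult h p = (THE m. \<exists>P. homog_expansion h p P \<and>
      m = (if \<forall>i. P i = (\<lambda>_. 0) then \<infinity> else enat (LEAST i. P i \<noteq> (\<lambda>_. 0))))"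

definition normal_family :: "(complex^'n) set \<Rightarrow> (complex^'n \<Rightarrow> complex) set \<Rightarrow> bool" where
  "normal_family D \<F> \<longleftrightarrow> (\<forall>s::nat \<Rightarrow> complex^'n \<Rightarrow> complex. (\<forall>k. s k \<in> \<F>) \<longrightarrow> (\<exists>r. strict_mono r \<and>
      ((\<exists>g. \<forall>K. compact K \<and> K \<subseteq> D \<longrightarrow> uniform_limit K (\<lambda>k. s (r k)) g sequentially) \<or>
       (\<forall>K. compact K \<and> K \<subseteq> D \<longrightarrow>
          (\<forall>M. eventually (\<lambda>k. \<forall>z\<in>K. M \<le> norm (s (r k) z)) sequentially)))))"

end

theory Submission
  imports Defs "HOL-Complex_Analysis.Complex_Analysis"
begin

text \<open>
  Normalise to \<open>F = (f - a) / (b - a)\<close>, which omits 0 and takes the value 1 only with multiplicity at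
  least two. On the plane punctured at 0 the metric
  \<open>(1 + \<bar>w\<bar>\<^sup>p) (1 + \<bar>w - 1\<bar>)\<^sup>u / (\<bar>w\<bar>\<^sup>t \<bar>w - 1\<bar>\<^sup>v) \<bar>dw\<bar>\<close> with \<open>p = 1/8\<close>, \<open>u = 1/4\<close>, \<open>t = 15/16\<close>,
  \<open>v = 1/2\<close> has curvature bounded above by a negative constant, and its singularity at 1 is mild enough
  for the pull-back under \<open>F\<close> on complex lines to be continuous, and smooth wherever it does not vanish.
  The maximum principle of the Ahlfors-Schwarz lemma therefore bounds the spherical derivative of \<open>F\<close>.
  So \<open>F\<close> stays away from 0 on a ball of controlled radius as soon as \<open>\<bar>F\<bar> \<ge> 1\<close> at its centre,
  and Schottky's theorem applies there: on small balls, a bound for \<open>F\<close> at one point gives a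
  bound at all points, uniformly in the family. By connectedness a sequence without a locally bounded
  subsequence diverges to infinity, and a locally bounded sequence has a convergent subsequence by Montel.
\<close>

subsection \<open>The Laplacian along lines\<close>

text \<open>The value 1 is not omitted, only ramified, so the theorems on functions omitting two
  values do not apply to \<open>F\<close> directly. Counting 1 for each of 0 and infinity and 1/2
  for the value 1 gives more than 2, and this leaves room for negative curvature. The metric has
  cone points there: |w|^(-15/16) |dw| and |w - 1|^(-1/2) |dw| are, up to constants, |dG| and |dK|
  for G = w^(1/16) and K = (w - 1)^(1/2), and the exponent at infinity, 1/8 + 1/4 - 15/16 - 1/2 =
  -17/16, is again that of a sixteenth root. The numerator is (1 + |G|^2) (1 + |K|^2)^(1/4): its
  first factor supplies the curvature near 0 and infinity, its second near 1. The exponents make the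
  Laplacian of the log density and the squared density grow alike at 0, 1 and infinity, namely as
  |w|^(-15/8), |w - 1|^(-1) and |w|^(-17/8). A bound on the spherical derivative alone confines
  \<open>F\<close> only on a ball that shrinks as the bound at its centre grows. Passing from ball
  to ball through \<open>D\<close> needs a radius independent of that bound; this is what Schottky's
  theorem adds.\<close>

definition has_second_deriv_along :: "(complex \<Rightarrow> real) \<Rightarrow> complex \<Rightarrow> complex \<Rightarrow> real \<Rightarrow> bool" where
  "has_second_deriv_along u z c d \<longleftrightarrow> (\<exists>D.
      (\<forall>\<^sub>F t in nhds 0. ((\<lambda>t. u (z + of_real t * c)) has_real_derivative D t) (at t)) \<and>
      (D has_real_derivative d) (at 0))"

text \<open>Only the two coordinate lines enter, because the maximum principle uses nothing beyond
  the one-variable second derivative test on each of them.\<close>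

definition has_laplacian :: "(complex \<Rightarrow> real) \<Rightarrow> complex \<Rightarrow> real \<Rightarrow> bool" where
  "has_laplacian u z L \<longleftrightarrow> (\<exists>d1 d2. has_second_deriv_along u z 1 d1 \<and>
      has_second_deriv_along u z \<i> d2 \<and> L = d1 + d2)"

lemma has_second_deriv_along_add:
  assumes "has_second_deriv_along u z c d" "has_second_deriv_along v z c e"
  shows "has_second_deriv_along (\<lambda>w. u w + v w) z c (d + e)"
proof -
  obtain D E where D: "\<forall>\<^sub>F t in nhds 0. ((\<lambda>t. u (z + of_real t * c)) has_real_derivative D t) (at t)"
    "(D has_real_derivative d) (at 0)"
    and E: "\<forall>\<^sub>F t in nhds 0. ((\<lambda>t. v (z + of_real t * c)) has_real_derivative E t) (at t)"
    "(E has_real_derivative e) (at 0)"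
    using assms unfolding has_second_deriv_along_def by blast
  have "\<forall>\<^sub>F t in nhds 0. ((\<lambda>t. u (z + of_real t * c) + v (z + of_real t * c)) has_real_derivative D t + E t) (at t)"
    using D(1) E(1) by eventually_elim (rule DERIV_add)
  then show ?thesis
    unfolding has_second_deriv_along_def
    by (intro exI[of _ "\<lambda>t. D t + E t"] conjI DERIV_add[OF D(2) E(2)])
qed

lemma has_second_deriv_along_cmult:
  assumes "has_second_deriv_along u z c d"
  shows "has_second_deriv_along (\<lambda>w. k * u w) z c (k * d)"
proof -
  obtain D where D: "\<forall>\<^sub>F t in nhds 0. ((\<lambda>t. u (z + of_real t * c)) has_real_derivative D t) (at t)"
    "(D has_real_derivative d) (at 0)"
    using assms unfolding has_second_deriv_along_def by blast
  have "\<forall>\<^sub>F t in nhds 0. ((\<lambda>t. k * u (z + of_real t * c)) has_real_derivative k * D t) (at t)"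
    using D(1) by eventually_elim (rule DERIV_cmult)
  then show ?thesis
    unfolding has_second_deriv_along_def
    by (intro exI[of _ "\<lambda>t. k * D t"] conjI DERIV_cmult[OF D(2)])
qed

lemma has_laplacian_add:
  assumes "has_laplacian u z L" "has_laplacian v z M"
  shows "has_laplacian (\<lambda>w. u w + v w) z (L + M)"
proof -
  obtain d1 d2 e1 e2 where "has_second_deriv_along u z 1 d1" "has_second_deriv_along u z \<i> d2" "L = d1 + d2"
    "has_second_deriv_along v z 1 e1" "has_second_deriv_along v z \<i> e2" "M = e1 + e2"
    using assms unfolding has_laplacian_def by blast
  then show ?thesis
    unfolding has_laplacian_def
    by (intro exI[of _ "d1 + e1"] exI[of _ "d2 + e2"]) (simp add: has_second_deriv_along_add)
qed

lemma has_laplacian_cmult: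
  assumes "has_laplacian u z L"
  shows "has_laplacian (\<lambda>w. k * u w) z (k * L)"
proof -
  obtain d1 d2 where "has_second_deriv_along u z 1 d1" "has_second_deriv_along u z \<i> d2" "L = d1 + d2"
    using assms unfolding has_laplacian_def by blast
  then show ?thesis
    unfolding has_laplacian_def
    by (intro exI[of _ "k * d1"] exI[of _ "k * d2"]) (simp add: has_second_deriv_along_cmult distrib_left)
qed

lemma tendsto_line: "((\<lambda>t. z + complex_of_real t * c) \<longlongrightarrow> z) (nhds 0)"
proof -
  have "((\<lambda>t. z + complex_of_real t * c) \<longlongrightarrow> z + complex_of_real 0 * c) (nhds 0)"
    by (intro tendsto_intros filterlim_ident)
  then show ?thesis by simp
qed

text \<open>If \<open>d\<close> were positive, the first derivative, zero at the maximum, would be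
  positive just to the right of 0, and \<open>u\<close> would increase along the line.\<close>

lemma second_deriv_along_local_max:
  assumes "has_second_deriv_along u z c d" and max: "\<forall>\<^sub>F w in nhds z. u w \<le> u z"
  shows "d \<le> 0"
proof (rule ccontr)
  assume "\<not> d \<le> 0"
  define \<phi> where "\<phi> t = u (z + of_real t * c)" for t
  obtain D where D: "\<forall>\<^sub>F t in nhds 0. (\<phi> has_real_derivative D t) (at t)"
    "(D has_real_derivative d) (at 0)"
    using assms(1) unfolding has_second_deriv_along_def \<phi>_def by blast
  have "\<forall>\<^sub>F t in nhds 0. \<phi> t \<le> \<phi> 0"
    unfolding \<phi>_def using filterlim_iff[THEN iffD1, OF tendsto_line, rule_format, OF max] by simp
  with D(1) have "\<forall>\<^sub>F t in nhds 0. (\<phi> has_real_derivative D t) (at t) \<and> \<phi> t \<le> \<phi> 0"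
    by (rule eventually_conj)
  then obtain e where e: "e > 0" "\<And>t. \<bar>t\<bar> < e \<Longrightarrow> (\<phi> has_real_derivative D t) (at t) \<and> \<phi> t \<le> \<phi> 0"
    unfolding eventually_nhds_metric dist_real_def by auto
  have "D 0 = 0"
    by (rule DERIV_local_max[of \<phi> _ 0 e]) (use e in auto)
  then obtain e' where e': "e' > 0" "\<And>h. 0 < h \<Longrightarrow> h < e' \<Longrightarrow> 0 < D h"
    using DERIV_pos_inc_right[OF D(2)] \<open>\<not> d \<le> 0\<close> by auto
  define h where "h = min e e' / 2"
  have h: "0 < h" "h < e" "h < e'"
    using e(1) e'(1) by (auto simp: h_def min_def)
  have "\<phi> 0 < \<phi> h"
  proof (rule DERIV_pos_imp_increasing_open[of 0 h \<phi>])
    show "continuous_on {0..h} \<phi>"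
      using e(2) h by (intro continuous_at_imp_continuous_on ballI) (force intro: DERIV_isCont)
  qed (use h e(2) e'(2) in force)+
  then show False
    using e(2)[of h] h by auto
qed

lemma laplacian_local_max:
  assumes "has_laplacian u z L" and "\<forall>\<^sub>F w in nhds z. u w \<le> u z"
  shows "L \<le> 0"
proof -
  obtain d1 d2 where "has_second_deriv_along u z 1 d1" "has_second_deriv_along u z \<i> d2" "L = d1 + d2"
    using assms unfolding has_laplacian_def by blast
  then show ?thesis
    using second_deriv_along_local_max assms(2) by (metis add_nonpos_nonpos)
qed

section \<open>Laplacians of Re G and of ln (A + e |G|^2)\<close>

lemma holomorphic_line_derivative:
  assumes "G holomorphic_on S" "open S" "z + of_real t * c \<in> S"
  shows "((\<lambda>t. Re (G (z + of_real t * c))) has_real_derivative Re (c * deriv G (z + of_real t * c))) (at t)"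
    and "((\<lambda>t. Im (G (z + of_real t * c))) has_real_derivative Im (c * deriv G (z + of_real t * c))) (at t)"
proof -
  have "(G has_field_derivative deriv G (z + of_real t * c)) (at (z + of_real t * c))"
    using assms by (rule holomorphic_derivI)
  moreover have "((\<lambda>t. z + of_real t * c) has_vector_derivative c) (at t)"
    by (auto intro!: derivative_eq_intros simp: has_vector_derivative_def scaleR_conv_of_real)
  ultimately have "(G \<circ> (\<lambda>t. z + of_real t * c) has_vector_derivative c * deriv G (z + of_real t * c)) (at t)"
    by (rule field_vector_diff_chain_at[rotated])
  then have *: "((\<lambda>t. G (z + of_real t * c)) has_vector_derivative c * deriv G (z + of_real t * c)) (at t)"
    by (simp add: o_def)
  show "((\<lambda>t. Re (G (z + of_real t * c))) has_real_derivative Re (c * deriv G (z + of_real t * c))) (at t)"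
    "((\<lambda>t. Im (G (z + of_real t * c))) has_real_derivative Im (c * deriv G (z + of_real t * c))) (at t)"
    using bounded_linear.has_vector_derivative[OF bounded_linear_Re *]
      bounded_linear.has_vector_derivative[OF bounded_linear_Im *]
    by (simp_all add: has_real_derivative_iff_has_vector_derivative)
qed

lemma eventually_line_in:
  assumes "open S" "z \<in> S"
  shows "\<forall>\<^sub>F t in nhds 0. z + complex_of_real t * c \<in> S"
  using topological_tendstoD[OF tendsto_line assms] .

lemma second_deriv_along_Re:
  assumes "G holomorphic_on S" "open S" "z \<in> S"
  shows "has_second_deriv_along (\<lambda>w. Re (G w)) z c (Re (c * c * deriv (deriv G) z))"
proof -
  have "deriv G holomorphic_on S"
    using assms by (simp add: holomorphic_deriv)
  then have "(\<lambda>w. c * deriv G w) holomorphic_on S"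
    by (intro holomorphic_on_mult holomorphic_on_const)
  note * = holomorphic_line_derivative(1)[OF this assms(2), of z 0 c]
  have "deriv (\<lambda>w. c * deriv G w) z = c * deriv (deriv G) z"
    using \<open>deriv G holomorphic_on S\<close> assms
    by (blast intro: deriv_cmult holomorphic_on_imp_differentiable_at)
  with * assms(3) have "((\<lambda>t. Re (c * deriv G (z + of_real t * c))) has_real_derivative
      Re (c * c * deriv (deriv G) z)) (at 0)"
    by (simp only: mult.assoc) simp
  moreover have "\<forall>\<^sub>F t in nhds 0. ((\<lambda>t. Re (G (z + of_real t * c))) has_real_derivative
      Re (c * deriv G (z + of_real t * c))) (at t)"
    using eventually_line_in[OF assms(2,3), of c]
    by eventually_elim (rule holomorphic_line_derivative[OF assms(1,2)])
  ultimately show ?thesis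
    unfolding has_second_deriv_along_def
    by (intro exI[of _ "\<lambda>t. Re (c * deriv G (z + of_real t * c))"] conjI)
qed

lemma laplacian_Re:
  assumes "G holomorphic_on S" "open S" "z \<in> S"
  shows "has_laplacian (\<lambda>w. Re (G w)) z 0"
  unfolding has_laplacian_def
  using second_deriv_along_Re[OF assms, of 1] second_deriv_along_Re[OF assms, of \<i>] by force

lemma second_deriv_along_ln:
  fixes c :: complex
  assumes G: "G holomorphic_on S" "open S" "z \<in> S" and pos: "A + e * (cmod (G z))\<^sup>2 > 0"
  defines "g \<equiv> G z" and "g1 \<equiv> c * deriv G z" and "g2 \<equiv> c * c * deriv (deriv G) z"
  defines "N \<equiv> A + e * (cmod (G z))\<^sup>2"
  shows "has_second_deriv_along (\<lambda>w. ln (A + e * (cmod (G w))\<^sup>2)) z c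
     ((e * (2 * ((cmod g1)\<^sup>2 + Re g * Re g2 + Im g * Im g2)) * N
       - (2 * e * (Re g * Re g1 + Im g * Im g1))\<^sup>2) / N\<^sup>2)"
proof -
  define p where "p t = Re (G (z + of_real t * c))" for t
  define q where "q t = Im (G (z + of_real t * c))" for t
  define p1 where "p1 t = Re (c * deriv G (z + of_real t * c))" for t
  define q1 where "q1 t = Im (c * deriv G (z + of_real t * c))" for t
  have hol': "(\<lambda>w. c * deriv G w) holomorphic_on S"
    using assms by (intro holomorphic_intros holomorphic_deriv)
  have dd: "deriv (\<lambda>w. c * deriv G w) z = c * deriv (deriv G) z"
    using holomorphic_deriv[OF G(1,2)] G
    by (blast intro: deriv_cmult holomorphic_on_imp_differentiable_at)
  have p1': "(p1 has_real_derivative Re g2) (at 0)" and q1': "(q1 has_real_derivative Im g2) (at 0)"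
    using holomorphic_line_derivative[OF hol' G(2), of z 0 c] G(3) dd
    by (simp_all only: p1_def[abs_def] q1_def[abs_def] g2_def mult.assoc) simp_all
  have pq': "(p has_real_derivative p1 t) (at t)" "(q has_real_derivative q1 t) (at t)"
    if "z + of_real t * c \<in> S" for t
    unfolding p_def q_def p1_def q1_def by (rule holomorphic_line_derivative[OF G(1,2) that])+
  have S: "\<forall>\<^sub>F t in nhds 0. z + complex_of_real t * c \<in> S"
    by (rule eventually_line_in[OF G(2,3)])
  define F where "F w = A + e * (cmod (G w))\<^sup>2" for w
  have "continuous_on S F"
    unfolding F_def using G by (intro continuous_intros holomorphic_on_imp_continuous_on)
  then have "isCont F z"
    using G by (simp add: continuous_on_eq_continuous_at)
  then have "(F \<longlongrightarrow> F z) (nhds z)"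
    unfolding isCont_def tendsto_at_iff_tendsto_nhds[symmetric] .
  moreover have "F z > 0"
    using pos by (simp add: F_def)
  ultimately have "\<forall>\<^sub>F w in nhds z. A + e * (cmod (G w))\<^sup>2 > 0"
    unfolding F_def[symmetric] by (rule order_tendstoD)
  then have P: "\<forall>\<^sub>F t in nhds 0. A + e * (cmod (G (z + complex_of_real t * c)))\<^sup>2 > 0"
    using filterlim_iff[THEN iffD1, OF tendsto_line, rule_format] by blast
  have n: "(cmod (G (z + complex_of_real t * c)))\<^sup>2 = (p t)\<^sup>2 + (q t)\<^sup>2" for t
    by (simp add: cmod_power2 p_def q_def)
  define D where "D t = e * (2 * (p t * p1 t + q t * q1 t)) / (A + e * ((p t)\<^sup>2 + (q t)\<^sup>2))" for t
  have "\<forall>\<^sub>F t in nhds 0. ((\<lambda>t. ln (A + e * (cmod (G (z + complex_of_real t * c)))\<^sup>2)) has_real_derivative D t) (at t)"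
    using S P unfolding n
  proof eventually_elim
    case (elim t)
    show ?case
      unfolding D_def
      by (rule derivative_eq_intros pq' elim refl | simp add: elim add_divide_distrib algebra_simps)+
  qed
  moreover have "(D has_real_derivative ((e * (2 * ((cmod g1)\<^sup>2 + Re g * Re g2 + Im g * Im g2)) * N
       - (2 * e * (Re g * Re g1 + Im g * Im g1))\<^sup>2) / N\<^sup>2)) (at 0)"
  proof -
    have v: "p 0 = Re g" "q 0 = Im g" "p1 0 = Re g1" "q1 0 = Im g1"
      by (simp_all add: p_def q_def p1_def q1_def g_def g1_def)
    have N: "N = A + e * ((Re g)\<^sup>2 + (Im g)\<^sup>2)" "N \<noteq> 0"
      using pos by (auto simp: N_def g_def cmod_power2)
    have 0: "(p has_real_derivative Re g1) (at 0)" "(q has_real_derivative Im g1) (at 0)"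
      using pq'[of 0] G(3) v by simp_all
    show ?thesis
      unfolding D_def cmod_power2
      apply (rule derivative_eq_intros 0 p1' q1' refl | simp add: v N(2) N(1)[symmetric])+
      by (simp add: power2_eq_square algebra_simps)
  qed
  ultimately show ?thesis
    unfolding has_second_deriv_along_def by blast
qed

text \<open>In the sum over \<open>c = 1\<close> and \<open>c = \<i>\<close> the terms with G''
  cancel and the two squares add up to 4 e^2 |G|^2 |G'|^2, so the numerator collapses to 4 e A
  |G'|^2. The case \<open>e = -1\<close> belongs to the hyperbolic density of a disc, the case
  \<open>e = 1\<close> to the spherical density.\<close>

lemma laplacian_ln:
  assumes G: "G holomorphic_on S" "open S" "z \<in> S" and pos: "A + e * (cmod (G z))\<^sup>2 > 0"
  shows "has_laplacian (\<lambda>w. ln (A + e * (cmod (G w))\<^sup>2)) z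
     (4 * e * A * (cmod (deriv G z))\<^sup>2 / (A + e * (cmod (G z))\<^sup>2)\<^sup>2)"
  unfolding has_laplacian_def
  apply (rule exI conjI second_deriv_along_ln[OF assms])+
  unfolding cmod_power2
  apply (simp only: add_divide_distrib[symmetric])
  apply (rule arg_cong[of _ _ "\<lambda>x. x / (A + e * ((Re (G z))\<^sup>2 + (Im (G z))\<^sup>2))\<^sup>2"])
  apply (simp add: power2_eq_square algebra_simps)
  done

subsection \<open>An Ahlfors estimate for ramified functions\<close>

text \<open>Where \<open>F = 1\<close> and \<open>F' = 0\<close>, the value \<open>2 F''\<close> is the limit of \<open>F'\<^sup>2 / (F - 1)\<close>.\<close>

definition ramified_quotient :: "(complex \<Rightarrow> complex) \<Rightarrow> complex \<Rightarrow> complex" where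
  "ramified_quotient F z = (if F z = 1 then 2 * deriv (deriv F) z else (deriv F z)\<^sup>2 / (F z - 1))"

text \<open>At a point where F = 1 to order n, F - 1 = (w - a)^n g and F' = (w - a)^(n-1) k, so the
  quotient is (w - a)^(n-2) k^2 / g. Ramification excludes n = 1, the only order that would leave a
  pole.\<close>

lemma ramified_quotient_holomorphic:
  assumes F: "F holomorphic_on S" "open S" "connected S" and nc: "\<not> F constant_on S"
    and ram: "\<And>z. z \<in> S \<Longrightarrow> F z = 1 \<Longrightarrow> deriv F z = 0"
  shows "ramified_quotient F holomorphic_on S"
proof -
  have "\<exists>U. open U \<and> a \<in> U \<and> U \<subseteq> S \<and> ramified_quotient F holomorphic_on U" if "a \<in> S" for a
  proof (cases "F a = 1")
    case False
    define U where "U = {z \<in> S. F z \<noteq> 1}"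
    have "U = S \<inter> F -` (- {1})"
      by (auto simp: U_def)
    moreover have "open (S \<inter> F -` (- {1}))"
      using F by (intro continuous_open_preimage holomorphic_on_imp_continuous_on) auto
    ultimately have "open U" by simp
    have "(\<lambda>z. (deriv F z)\<^sup>2 / (F z - 1)) holomorphic_on U"
      using F \<open>open U\<close>
      by (intro holomorphic_intros) (auto simp: U_def elim: holomorphic_on_subset)
    then have "ramified_quotient F holomorphic_on U"
      by (rule holomorphic_transform) (auto simp: U_def ramified_quotient_def)
    then show ?thesis
      using \<open>open U\<close> False that by (intro exI[of _ U]) (auto simp: U_def)
  next
    case True
    have h1: "(\<lambda>z. F z - 1) holomorphic_on S"
      using F by (intro holomorphic_intros)
    have h2: "\<not> (\<lambda>z. F z - 1) constant_on S"
      using nc unfolding constant_on_def by (metis diff_add_cancel)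
    obtain g r n where g: "0 < n" "0 < r" "ball a r \<subseteq> S" "g holomorphic_on ball a r"
      "\<And>w. w \<in> ball a r \<Longrightarrow> F w - 1 = (w - a) ^ n * g w" "\<And>w. w \<in> ball a r \<Longrightarrow> g w \<noteq> 0"
      by (rule holomorphic_factor_zero_nonconstant[OF h1 F(2,3) \<open>a \<in> S\<close> _ h2]) (use True in auto)
    define k where "k w = of_nat n * g w + (w - a) * deriv g w" for w
    have g': "deriv g holomorphic_on ball a r"
      using g(4) by (intro holomorphic_deriv) auto
    have k: "k holomorphic_on ball a r"
      unfolding k_def by (intro holomorphic_intros g(4) g')
    have F': "deriv F w = (w - a) ^ (n - 1) * k w" if w: "w \<in> ball a r" for w
    proof (rule DERIV_imp_deriv)
      have "((\<lambda>w. 1 + (w - a) ^ n * g w) has_field_derivative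
          of_nat n * (w - a) ^ (n - 1) * g w + (w - a) ^ n * deriv g w) (at w)"
        by (rule derivative_eq_intros refl holomorphic_derivI[OF g(4)] w open_ball | simp)+
      also have "of_nat n * (w - a) ^ (n - 1) * g w + (w - a) ^ n * deriv g w = (w - a) ^ (n - 1) * k w"
        using g(1) by (cases n) (auto simp: k_def algebra_simps)
      finally show "(F has_field_derivative (w - a) ^ (n - 1) * k w) (at w)"
      proof (rule has_field_derivative_transform_within_open[OF _ open_ball w])
        fix x assume "x \<in> ball a r"
        show "1 + (x - a) ^ n * g x = F x"
          using g(5)[OF \<open>x \<in> ball a r\<close>] by (metis add.commute diff_add_cancel)
      qed
    qed
    have a: "a \<in> ball a r"
      using g(2) by simp
    have "n \<noteq> 1"
    proof
      assume "n = 1"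
      then have "deriv F a = g a"
        using F'[OF a] by (simp add: k_def)
      then show False
        using ram[OF \<open>a \<in> S\<close> True] g(6)[OF a] by simp
    qed
    then obtain m where m: "n = Suc (Suc m)"
      using g(1) by (metis One_nat_def Suc_pred old.nat.exhaust not_gr_zero)
    define q where "q w = (w - a) ^ m * (k w)\<^sup>2 / g w" for w
    have "ramified_quotient F w = q w" if w: "w \<in> ball a r" for w
    proof (cases "w = a")
      case False
      have "F w \<noteq> 1"
        using g(5,6)[OF w] False by auto
      then have "ramified_quotient F w = (deriv F w)\<^sup>2 / (F w - 1)"
        by (simp add: ramified_quotient_def)
      also have "\<dots> = q w"
      proof -
        have "(t ^ Suc m * k w)\<^sup>2 / (t ^ Suc (Suc m) * g w) = t ^ m * (k w)\<^sup>2 / g w" if "t \<noteq> 0" for t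
          using that by (simp add: power2_eq_square)
        then show ?thesis
          unfolding g(5)[OF w] F'[OF w] q_def m using False by simp
      qed
      finally show ?thesis .
    next
      case True
      \<comment> \<open>At the centre the quotient is 2 F''. For n = 2 this and \<open>q a\<close>
        both equal 4 g(a); for n > 2 both vanish.\<close>
      have "deriv (deriv F) a = (if m = 0 then k a else 0)"
      proof (rule DERIV_imp_deriv)
        have "((\<lambda>w. (w - a) ^ Suc m * k w) has_field_derivative
          of_nat (Suc m) * (a - a) ^ m * k a + (a - a) ^ Suc m * deriv k a) (at a)"
          by (rule derivative_eq_intros refl holomorphic_derivI[OF k] a open_ball | simp)+
        also have "of_nat (Suc m) * (a - a) ^ m * k a + (a - a) ^ Suc m * deriv k a = (if m = 0 then k a else 0)"
          by (cases m) auto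
        finally show "(deriv F has_field_derivative (if m = 0 then k a else 0)) (at a)"
          by (rule has_field_derivative_transform_within_open[OF _ open_ball a]) (simp add: F' m)
      qed
      then show ?thesis
        using True \<open>F a = 1\<close> g(6)[OF a] by (simp add: ramified_quotient_def q_def k_def m power2_eq_square)
    qed
    moreover have "q holomorphic_on ball a r"
      unfolding q_def using g(6) by (intro holomorphic_intros k g(4)) auto
    ultimately have "ramified_quotient F holomorphic_on ball a r"
      using holomorphic_transform by metis
    then show ?thesis
      using a g(3) by blast
  qed
  then show ?thesis
    by (metis F(2) holomorphic_on_imp_differentiable_at holomorphic_on_def field_differentiable_at_within)
qed

text \<open>With |F - 1| = |K|^2 the factor 1 + |F - 1| of the metric takes the form handled by
  \<open>laplacian_ln\<close>, and F' = 2 K K' gives 4 K'^2 = F'^2 / (F - 1). Away from the value 1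
  the root comes from a logarithm; at the value 1 the nonzero quotient forces order exactly
  two.\<close>

lemma ramified_square_root:
  assumes F: "F holomorphic_on S" "open S" "a \<in> S"
    and ram: "F a = 1 \<Longrightarrow> deriv F a = 0" and nz: "ramified_quotient F a \<noteq> 0"
  obtains K r where "r > 0" "ball a r \<subseteq> S" "K holomorphic_on ball a r"
    "\<And>w. w \<in> ball a r \<Longrightarrow> (K w)\<^sup>2 = F w - 1" "4 * (deriv K a)\<^sup>2 = ramified_quotient F a"
proof (cases "F a = 1")
  case False
  have "continuous_on S F"
    using F by (intro holomorphic_on_imp_continuous_on)
  then have "open (S \<inter> F -` (- {1}))"
    using F by (intro continuous_open_preimage) auto
  moreover have "a \<in> S \<inter> F -` (- {1})"
    using F False by auto
  ultimately obtain r where r: "r > 0" "ball a r \<subseteq> S \<inter> F -` (- {1})"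
    using open_contains_ball by metis
  have hol: "F holomorphic_on ball a r"
    using F(1) by (rule holomorphic_on_subset) (use r in auto)
  obtain h where h: "h holomorphic_on ball a r" "\<And>x. x \<in> ball a r \<Longrightarrow> exp (h x) = F x - 1"
    by (rule holomorphic_logarithm_exists[of "ball a r" "\<lambda>z. F z - 1" a])
       (use hol r in \<open>auto intro!: holomorphic_intros\<close>)
  define K where "K w = exp (h w / 2)" for w
  have K: "K holomorphic_on ball a r"
    unfolding K_def by (intro holomorphic_intros h(1)) auto
  have sq: "(K w)\<^sup>2 = F w - 1" if "w \<in> ball a r" for w
    using h(2)[OF that] by (simp add: K_def power2_eq_square exp_add[symmetric])
  have a: "a \<in> ball a r" using r by simp
  have "((\<lambda>w. (K w)\<^sup>2 + 1) has_field_derivative 2 * K a * deriv K a) (at a)"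
    by (rule derivative_eq_intros refl holomorphic_derivI[OF K] a open_ball | simp)+
  then have "(F has_field_derivative 2 * K a * deriv K a) (at a)"
    by (rule has_field_derivative_transform_within_open[OF _ open_ball a]) (simp add: sq)
  then have "deriv F a = 2 * K a * deriv K a"
    by (rule DERIV_imp_deriv)
  then have "4 * (deriv K a)\<^sup>2 = ramified_quotient F a"
    using False sq[OF a, symmetric] by (auto simp: ramified_quotient_def field_simps power2_eq_square)
  then show ?thesis
    using that[of r K] r K sq by auto
next
  case True
  then have 0: "deriv F a = 0" and 2: "deriv (deriv F) a \<noteq> 0"
    using ram nz by (auto simp: ramified_quotient_def)
  obtain g r0 where g0: "0 < r0" "g holomorphic_on ball a r0"
    "\<And>w. w \<in> ball a r0 \<Longrightarrow> F w - F a = ((w - a) * g w) ^ 2"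
  proof (rule holomorphic_factor_order_of_zero_strong[OF F, of 2])
    show "(deriv ^^ 2) F a \<noteq> 0"
      using 2 by (simp add: numeral_2_eq_2)
    show "(deriv ^^ i) F a = 0" if "0 < i" "i < 2" for i
    proof -
      have "i = 1" using that by simp
      then show ?thesis using 0 by simp
    qed
  qed auto
  obtain r1 where r1: "r1 > 0" "ball a r1 \<subseteq> S"
    using F open_contains_ball by metis
  define r where "r = min r0 r1"
  have r: "r > 0" "ball a r \<subseteq> ball a r0" "ball a r \<subseteq> S"
    using g0(1) r1 by (auto simp: r_def)
  have a: "a \<in> ball a r" using r by simp
  define K where "K w = (w - a) * g w" for w
  have g: "g holomorphic_on ball a r"
    using g0(2) r(2) by (rule holomorphic_on_subset)
  have K: "K holomorphic_on ball a r"
    unfolding K_def by (intro holomorphic_intros g)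
  have sq: "(K w)\<^sup>2 = F w - 1" if "w \<in> ball a r" for w
    using g0(3)[of w] that r(2) True by (auto simp: K_def)
  have F': "deriv F w = 2 * K w * deriv K w" if w: "w \<in> ball a r" for w
  proof (rule DERIV_imp_deriv)
    have "((\<lambda>w. (K w)\<^sup>2 + 1) has_field_derivative 2 * K w * deriv K w) (at w)"
      by (rule derivative_eq_intros refl holomorphic_derivI[OF K] w open_ball | simp)+
    then show "(F has_field_derivative 2 * K w * deriv K w) (at w)"
      by (rule has_field_derivative_transform_within_open[OF _ open_ball w]) (simp add: sq)
  qed
  have K': "deriv K holomorphic_on ball a r"
    using K by (intro holomorphic_deriv) auto
  have "deriv (deriv F) a = 2 * (deriv K a)\<^sup>2"
  proof (rule DERIV_imp_deriv)
    have "((\<lambda>w. 2 * K w * deriv K w) has_field_derivative 2 * (deriv K a)\<^sup>2) (at a)"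
      by (rule derivative_eq_intros refl holomorphic_derivI[OF K] holomorphic_derivI[OF K'] a open_ball
         | simp add: K_def power2_eq_square)+
    then show "(deriv F has_field_derivative 2 * (deriv K a)\<^sup>2) (at a)"
      by (rule has_field_derivative_transform_within_open[OF _ open_ball a]) (simp add: F')
  qed
  then have "4 * (deriv K a)\<^sup>2 = ramified_quotient F a"
    using True by (simp add: ramified_quotient_def)
  then show ?thesis
    using that[of r K] r K sq by auto
qed

lemma norm_deriv_ramified_quotient:
  assumes "F z = 1 \<Longrightarrow> deriv F z = 0"
  shows "(cmod (deriv F z))\<^sup>2 = cmod (ramified_quotient F z) * cmod (F z - 1)"
  using assms by (auto simp: ramified_quotient_def norm_divide norm_power)

text \<open>For \<open>x\<^sup>8 = \<bar>w\<bar>\<close> and \<open>y = \<bar>w - 1\<bar>\<close> this is the negative upper bound on the curvature of the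
  metric of the introduction, with the denominators cleared.\<close>

lemma curvature_inequality:
  fixes x y :: real
  assumes x: "x > 0" and y: "y \<ge> 0" and y1: "x ^ 8 \<le> 1 + y" and y2: "1 \<le> x ^ 8 + y"
  shows "(1 + x) ^ 4 * (1 + y) \<le> 589824 * (y / (16 * (1 + x)\<^sup>2) + x ^ 15 / (1 + y)\<^sup>2)\<^sup>2"
proof (cases "y \<ge> 1/2")
  \<comment> \<open>Away from w = 1 the first summand alone is large enough.\<close>
  case True
  \<comment> \<open>Three rounds of (1 + t)^2 \<le> 2 (1 + t^2), with t = x, x^2, x^4.\<close>
  have conv: "(1 + x) ^ 8 \<le> 2 ^ 7 * (1 + x ^ 8)"
  proof -
    have sq: "(1 + t)\<^sup>2 \<le> 2 * (1 + t\<^sup>2)" for t :: real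
      using zero_le_power2[of "1 - t"] by (simp add: power2_eq_square algebra_simps)
    have "((1 + x)\<^sup>2)\<^sup>2 \<le> (2 * (1 + x\<^sup>2))\<^sup>2"
      by (intro power_mono sq) auto
    also have "\<dots> = 4 * (1 + x\<^sup>2)\<^sup>2"
      by (simp only: power_mult_distrib) simp
    also have "\<dots> \<le> 4 * (2 * (1 + (x\<^sup>2)\<^sup>2))"
      by (intro mult_left_mono sq) auto
    finally have "(((1 + x)\<^sup>2)\<^sup>2)\<^sup>2 \<le> (8 * (1 + (x\<^sup>2)\<^sup>2))\<^sup>2"
      by (intro power_mono) auto
    also have "\<dots> = 64 * (1 + (x\<^sup>2)\<^sup>2)\<^sup>2"
      by (simp only: power_mult_distrib) simp
    also have "\<dots> \<le> 64 * (2 * (1 + ((x\<^sup>2)\<^sup>2)\<^sup>2))"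
      by (intro mult_left_mono sq) auto
    finally show ?thesis
      by (simp flip: power_mult)
  qed
  \<comment> \<open>The threshold 1/2 enters as y \<ge> (1 + y) / 3; squaring then produces 2304 =
    (3 * 16)^2.\<close>
  have "y / (16 * (1 + x)\<^sup>2) \<ge> ((1 + y) / 3) / (16 * (1 + x)\<^sup>2)"
    using True by (intro divide_right_mono) auto
  moreover have "x ^ 15 / (1 + y)\<^sup>2 \<ge> 0"
    using x by auto
  ultimately have "(y / (16 * (1 + x)\<^sup>2) + x ^ 15 / (1 + y)\<^sup>2)\<^sup>2 \<ge> (((1 + y) / 3) / (16 * (1 + x)\<^sup>2))\<^sup>2"
    using y by (intro power_mono) auto
  moreover have "(((1 + y) / 3) / (16 * (1 + x)\<^sup>2))\<^sup>2 = (1 + y)\<^sup>2 / (2304 * (1 + x) ^ 4)"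
    by (simp add: power_divide power_mult_distrib flip: power_mult)
  \<comment> \<open>589824 = 256 * 2304, where 256 comes from (1 + x)^8 \<le> 128 (2 + y) \<le> 256
    (1 + y).\<close>
  moreover have "(1 + x) ^ 4 * (1 + y) \<le> 589824 * ((1 + y)\<^sup>2 / (2304 * (1 + x) ^ 4))"
  proof -
    have "(1 + x) ^ 8 \<le> 256 * (1 + y)"
      using conv y1 y2 True by auto
    then have "(1 + x) ^ 8 * (1 + y) \<le> 256 * (1 + y) * (1 + y)"
      using y by (intro mult_right_mono) auto
    then have "((1 + x) ^ 4 * (1 + y)) * (1 + x) ^ 4 \<le> 256 * (1 + y)\<^sup>2"
      by (simp add: power2_eq_square mult_ac flip: power_add)
    moreover have "(1 + x) ^ 4 > 0"
      using x by (intro zero_less_power) auto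
    ultimately have "(1 + x) ^ 4 * (1 + y) \<le> 256 * (1 + y)\<^sup>2 / (1 + x) ^ 4"
      by (simp only: pos_le_divide_eq)
    also have "\<dots> = 589824 * ((1 + y)\<^sup>2 / (2304 * (1 + x) ^ 4))"
      by simp
    finally show ?thesis .
  qed
  ultimately show ?thesis
    by linarith
next
  \<comment> \<open>Near w = 1 the second summand takes over: |w| lies between 1/2 and 3/2, so x is
    bounded above and x^15 below, and crude constants suffice.\<close>
  case False
  have "x < 2"
  proof (rule ccontr)
    assume "\<not> x < 2"
    then have "2 ^ 8 \<le> x ^ 8" by (intro power_mono) auto
    then show False using y1 False by simp
  qed
  have "x ^ 15 \<ge> 1/4"
  proof (cases "x \<le> 1")
    case True
    have "(1/2)\<^sup>2 \<le> (x ^ 8)\<^sup>2"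
      using y2 False by (intro power_mono) auto
    then have "1/4 \<le> x ^ 16"
      by (simp add: power2_eq_square flip: power_add)
    also have "\<dots> \<le> x ^ 15"
      using x True by (intro power_decreasing) auto
    finally show ?thesis .
  next
    case False
    then have "1 \<le> x ^ 15" by (intro one_le_power) auto
    then show ?thesis by simp
  qed
  have "(1 + y)\<^sup>2 \<le> (3/2)\<^sup>2"
    using y False by (intro power_mono) auto
  then have "(1/4) / (9/4) \<le> x ^ 15 / (1 + y)\<^sup>2"
    using \<open>x ^ 15 \<ge> 1/4\<close> x y by (intro frac_le) (auto simp: power2_eq_square)
  moreover have "y / (16 * (1 + x)\<^sup>2) \<ge> 0"
    using y x by auto
  ultimately have "(1/9)\<^sup>2 \<le> (y / (16 * (1 + x)\<^sup>2) + x ^ 15 / (1 + y)\<^sup>2)\<^sup>2"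
    by (intro power_mono) auto
  moreover have "(1 + x) ^ 4 * (1 + y) \<le> 3 ^ 4 * (3/2)"
    using \<open>x < 2\<close> x y False by (intro mult_mono power_mono) auto
  ultimately show ?thesis
    by (simp add: power2_eq_square)
qed


text \<open>The function \<open>W\<close> is positive at 0 and vanishes on the circle of radius
  \<open>r\<close>, so its maximum over the disc is interior. There ln W has nonpositive Laplacian:
  the curvature of the metric is outweighed by the hyperbolic term from (r^2 - |z|^2)^4. As W 0 is
  at most the maximum, the resulting bound reaches the centre. Fourth powers make all exponents in
  \<open>x\<close> and \<open>y\<close> integral.\<close>

lemma ramified_derivative_bound:
  assumes F: "F holomorphic_on ball 0 R" and r: "0 < r" "r < R"
    and nz: "\<And>z. z \<in> ball 0 R \<Longrightarrow> F z \<noteq> 0"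
    and ram: "\<And>z. z \<in> ball 0 R \<Longrightarrow> F z = 1 \<Longrightarrow> deriv F z = 0"
  shows "cmod (deriv F 0) * r \<le> 132 * (1 + (cmod (F 0))\<^sup>2)"
proof (cases "deriv F 0 = 0")
  case True
  then show ?thesis by simp
next
  case False
  have 0: "0 \<in> ball (0::complex) R"
    using r by simp
  have nc: "\<not> F constant_on ball 0 R"
  proof
    assume "F constant_on ball 0 R"
    then obtain c where c: "\<And>z. z \<in> ball 0 R \<Longrightarrow> F z = c"
      unfolding constant_on_def by blast
    have "((\<lambda>z. c) has_field_derivative 0) (at (0::complex))" by simp
    then have "(F has_field_derivative 0) (at 0)"
      by (rule has_field_derivative_transform_within_open[OF _ open_ball 0]) (simp add: c)
    then show False
      using False DERIV_imp_deriv by blast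
  qed
  define Q where "Q = ramified_quotient F"
  have Q: "Q holomorphic_on ball 0 R"
    unfolding Q_def by (intro ramified_quotient_holomorphic F nc ram) auto
  obtain H where H: "H holomorphic_on ball 0 R" "\<And>z. z \<in> ball 0 R \<Longrightarrow> exp (H z) = F z"
    by (rule holomorphic_logarithm_exists[of "ball 0 R" F 0]) (use F nz 0 in auto)
  \<comment> \<open>A sixteenth root of F, so that |G|^2 = |F|^(1/8) and F' / F^(15/16) = 16
    G'.\<close>
  define G where "G z = exp (H z / 16)" for z
  have G: "G holomorphic_on ball 0 R"
    unfolding G_def by (intro holomorphic_intros H) auto
  have Gpos: "cmod (G z) > 0" for z
    by (simp add: G_def)
  have G16: "G z ^ 16 = F z" if "z \<in> ball 0 R" for z
    using H(2)[OF that] by (simp add: G_def flip: exp_of_nat_mult)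
  define x where "x z = (cmod (G z))\<^sup>2" for z
  define y where "y z = cmod (F z - 1)" for z
  have xpos: "x z > 0" for z
    using Gpos[of z] by (simp add: x_def)
  have x8: "x z ^ 8 = cmod (F z)" if "z \<in> ball 0 R" for z
    by (simp add: x_def norm_power flip: power_mult G16[OF that])
  have y: "y z \<ge> 0" "cmod (F z) \<le> 1 + y z" "1 \<le> cmod (F z) + y z" "y z \<le> 1 + cmod (F z)" for z
  proof -
    show "cmod (F z) \<le> 1 + y z" "1 \<le> cmod (F z) + y z" "y z \<le> 1 + cmod (F z)"
      using norm_triangle_ineq[of 1 "F z - 1"] norm_triangle_ineq4[of "F z" "F z - 1"] norm_triangle_ineq4[of "F z" 1]
      by (auto simp: y_def)
  qed (simp add: y_def)
  have F'Q: "(cmod (deriv F z))\<^sup>2 = cmod (Q z) * y z" if "z \<in> ball 0 R" for z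
    unfolding Q_def y_def by (rule norm_deriv_ramified_quotient) (rule ram[OF that])
  \<comment> \<open>the fourth power of \<open>r\<^sup>2 - \<bar>z\<bar>\<^sup>2\<close> times the density of the pulled back metric\<close>
  define W where "W z = (r\<^sup>2 - (cmod z)\<^sup>2) ^ 4 * ((1 + x z) ^ 4 * (1 + y z) * (cmod (Q z))\<^sup>2 / x z ^ 30)" for z
  have sub: "cball 0 r \<subseteq> ball 0 R"
    using r by auto
  have cont: "continuous_on (ball 0 R) W"
    unfolding W_def x_def y_def using Gpos
    by (intro continuous_intros holomorphic_on_imp_continuous_on G F Q) auto
  obtain z0 where z0: "z0 \<in> cball 0 r" "\<And>z. z \<in> cball 0 r \<Longrightarrow> W z \<le> W z0"
    using continuous_attains_sup[of "cball 0 r" W] cont sub r continuous_on_subset by (metis cball_eq_empty compact_cball linorder_not_less order_less_imp_le)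
  have Q0: "Q 0 \<noteq> 0"
    using F'Q[OF 0] False by auto
  have "W 0 > 0"
    unfolding W_def using r xpos[of 0] y(1)[of 0] Q0
    by (intro mult_pos_pos divide_pos_pos zero_less_power) (auto intro: add_pos_nonneg)
  then have Wpos: "W z0 > 0"
    using z0(2)[of 0] r by simp
  \<comment> \<open>Positivity of the maximum keeps \<open>z0\<close> off the zeros of
    \<open>Q\<close> and off the boundary circle; the former gives a root \<open>K\<close> of F - 1
    and a logarithm of \<open>Q\<close> near \<open>z0\<close>.\<close>
  have "Q z0 \<noteq> 0"
    using Wpos by (auto simp: W_def)
  have "cmod z0 \<noteq> r"
    using Wpos by (auto simp: W_def)
  with z0(1) have z0r: "cmod z0 < r" by auto
  with r have z0R: "z0 \<in> ball 0 R" by auto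
  define m where "m = r\<^sup>2 - (cmod z0)\<^sup>2"
  have mpos: "m > 0"
    using z0r by (simp add: m_def power_strict_mono)
  obtain K d1 where K: "d1 > 0" "ball z0 d1 \<subseteq> ball 0 R" "K holomorphic_on ball z0 d1"
    "\<And>w. w \<in> ball z0 d1 \<Longrightarrow> (K w)\<^sup>2 = F w - 1" "4 * (deriv K z0)\<^sup>2 = Q z0"
    using ramified_square_root[OF F open_ball z0R] ram[OF z0R] \<open>Q z0 \<noteq> 0\<close> unfolding Q_def by metis
  have "open (ball 0 R \<inter> Q -` (- {0}))"
    using Q by (intro continuous_open_preimage holomorphic_on_imp_continuous_on) auto
  then have "open (ball z0 d1 \<inter> ball 0 r \<inter> (ball 0 R \<inter> Q -` (- {0})))"
    by (rule open_Int[OF open_Int[OF open_ball open_ball]])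
  moreover have "z0 \<in> ball z0 d1 \<inter> ball 0 r \<inter> (ball 0 R \<inter> Q -` (- {0}))"
    using K(1) z0r z0R \<open>Q z0 \<noteq> 0\<close> by auto
  ultimately obtain d where d: "d > 0" "ball z0 d \<subseteq> ball z0 d1 \<inter> ball 0 r \<inter> (ball 0 R \<inter> Q -` (- {0}))"
    using open_contains_ball by metis
  have z0d: "z0 \<in> ball z0 d" using d by simp
  have holQ: "Q holomorphic_on ball z0 d" and holH: "H holomorphic_on ball z0 d"
    by (rule holomorphic_on_subset[OF Q] holomorphic_on_subset[OF H(1)], use d(2) in auto)+
  obtain q where q: "q holomorphic_on ball z0 d" "\<And>z. z \<in> ball z0 d \<Longrightarrow> exp (q z) = Q z"
    by (rule holomorphic_logarithm_exists[of "ball z0 d" Q z0]) (use holQ d z0d in auto)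
  \<comment> \<open>Since ln x = Re H / 8, the real part of \<open>e\<close> is 2 ln |Q| - 30 ln x;
    it is harmonic and drops out of the Laplacian.\<close>
  define e where "e w = 2 * q w - 15 / 4 * H w" for w
  have e: "e holomorphic_on ball z0 d"
    unfolding e_def by (intro holomorphic_intros q(1) holH)
  \<comment> \<open>The coefficients -1 and 1 are written out so that each logarithm is literally an
    instance of \<open>laplacian_ln\<close>.\<close>
  define u where "u w = 4 * ln (r\<^sup>2 + (-1) * (cmod w)\<^sup>2) + (4 * ln (1 + 1 * (cmod (G w))\<^sup>2)
      + (ln (1 + 1 * (cmod (K w))\<^sup>2) + Re (e w)))" for w
  have uW: "u w = ln (W w)" and Wp: "W w > 0" if w: "w \<in> ball z0 d" for w
  proof -
    have w': "w \<in> ball 0 R" "w \<in> ball z0 d1" "w \<in> ball 0 r" "Q w \<noteq> 0"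
      using w d(2) by auto
    have "(cmod w)\<^sup>2 < r\<^sup>2"
      using w' by (intro power_strict_mono) auto
    then have p1: "r\<^sup>2 - (cmod w)\<^sup>2 > 0" by simp
    have p2: "1 + x w > 0" "1 + y w > 0"
      using xpos[of w] y(1)[of w] by auto
    have yK: "(cmod (K w))\<^sup>2 = y w"
      using K(4)[OF w'(2)] by (simp add: y_def norm_power[symmetric])
    have "cmod (Q w) = exp (Re (q w))"
      using q(2)[OF w] norm_exp_eq_Re by metis
    then have lQ: "ln (cmod (Q w)) = Re (q w)" by simp
    have "x w = exp (Re (H w) / 8)"
      by (simp add: x_def G_def power2_eq_square flip: exp_add)
    then have lx: "ln (x w) = Re (H w) / 8" by simp
    have "ln (W w) = 4 * ln (r\<^sup>2 - (cmod w)\<^sup>2) + (4 * ln (1 + x w) + ln (1 + y w) + 2 * ln (cmod (Q w)) - 30 * ln (x w))"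
      unfolding W_def using p1 p2 w'(4) xpos[of w]
      by (simp add: ln_mult ln_div ln_realpow)
    also have "\<dots> = u w"
      unfolding u_def e_def lQ lx yK by (simp add: x_def)
    finally show "u w = ln (W w)" by simp
    show "W w > 0"
      unfolding W_def using p1 p2 w'(4) xpos[of w] by (intro mult_pos_pos divide_pos_pos zero_less_power) auto
  qed
  have "\<forall>\<^sub>F w in nhds z0. w \<in> ball z0 d"
    using z0d by (intro eventually_nhds_in_open) auto
  then have umax: "\<forall>\<^sub>F w in nhds z0. u w \<le> u z0"
  proof eventually_elim
    case (elim w)
    have "W w \<le> W z0"
      using d(2) elim by (intro z0(2)) auto
    then show ?case
      using uW[OF elim] uW[OF z0d] Wp[OF elim] Wp[OF z0d] by simp
  qed
  have yK: "(cmod (K z0))\<^sup>2 = y z0"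
    using K(1) K(4)[of z0] by (simp add: y_def norm_power[symmetric])
  have lap: "has_laplacian u z0
     (4 * (4 * (-1) * r\<^sup>2 * (cmod (deriv (\<lambda>w. w) z0))\<^sup>2 / (r\<^sup>2 + (-1) * (cmod z0)\<^sup>2)\<^sup>2) +
     (4 * (4 * 1 * 1 * (cmod (deriv G z0))\<^sup>2 / (1 + 1 * (cmod (G z0))\<^sup>2)\<^sup>2) +
     (4 * 1 * 1 * (cmod (deriv K z0))\<^sup>2 / (1 + 1 * (cmod (K z0))\<^sup>2)\<^sup>2 + 0)))"
    unfolding u_def
  proof (intro has_laplacian_add has_laplacian_cmult)
    show "has_laplacian (\<lambda>w. ln (r\<^sup>2 + - 1 * (cmod w)\<^sup>2)) z0
     (4 * - 1 * r\<^sup>2 * (cmod (deriv (\<lambda>w. w) z0))\<^sup>2 / (r\<^sup>2 + - 1 * (cmod z0)\<^sup>2)\<^sup>2)"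
      using mpos by (intro laplacian_ln[of "\<lambda>w. w" UNIV]) (auto simp: m_def)
    show "has_laplacian (\<lambda>w. ln (1 + 1 * (cmod (G w))\<^sup>2)) z0
     (4 * 1 * 1 * (cmod (deriv G z0))\<^sup>2 / (1 + 1 * (cmod (G z0))\<^sup>2)\<^sup>2)"
      by (rule laplacian_ln[OF G open_ball z0R]) (simp add: add_pos_nonneg)
    show "has_laplacian (\<lambda>w. ln (1 + 1 * (cmod (K w))\<^sup>2)) z0
     (4 * 1 * 1 * (cmod (deriv K z0))\<^sup>2 / (1 + 1 * (cmod (K z0))\<^sup>2)\<^sup>2)"
      by (rule laplacian_ln[OF K(3) open_ball]) (use K(1) in \<open>simp_all add: add_pos_nonneg\<close>)
    show "has_laplacian (\<lambda>w. Re (e w)) z0 0"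
      by (rule laplacian_Re[OF e open_ball z0d])
  qed
  have K': "(cmod (deriv K z0))\<^sup>2 = cmod (Q z0) / 4"
    by (simp add: norm_mult norm_power flip: K(5))
  \<comment> \<open>Differentiating F = G^16 and using |F'|^2 = |Q| y expresses |G'|^2 through |Q|,
    as \<open>K'\<close> does for |K'|^2; so |Q| factors out of both curvature terms.\<close>
  have "((\<lambda>w. G w ^ 16) has_field_derivative 16 * G z0 ^ 15 * deriv G z0) (at z0)"
    by (rule derivative_eq_intros refl holomorphic_derivI[OF G] z0R open_ball | simp)+
  then have "(F has_field_derivative 16 * G z0 ^ 15 * deriv G z0) (at z0)"
    by (rule has_field_derivative_transform_within_open[OF _ open_ball z0R]) (simp add: G16)
  then have "deriv F z0 = 16 * G z0 ^ 15 * deriv G z0"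
    by (rule DERIV_imp_deriv)
  then have "(cmod (deriv F z0))\<^sup>2 = 256 * x z0 ^ 15 * (cmod (deriv G z0))\<^sup>2"
    by (simp add: norm_mult norm_power power_mult_distrib x_def flip: power_mult)
  then have G': "(cmod (deriv G z0))\<^sup>2 = cmod (Q z0) * y z0 / (256 * x z0 ^ 15)"
    using F'Q[OF z0R] xpos[of z0] by (simp add: field_simps)
  have "4 * (4 * r\<^sup>2 / m\<^sup>2) \<ge> 4 * (4 * (cmod (Q z0) * y z0 / (256 * x z0 ^ 15)) / (1 + x z0)\<^sup>2) + cmod (Q z0) / (1 + y z0)\<^sup>2"
    using laplacian_local_max[OF lap umax] unfolding K' G' yK by (simp add: x_def m_def)
  also have "4 * (4 * (cmod (Q z0) * y z0 / (256 * x z0 ^ 15)) / (1 + x z0)\<^sup>2) + cmod (Q z0) / (1 + y z0)\<^sup>2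
     = cmod (Q z0) / x z0 ^ 15 * (y z0 / (16 * (1 + x z0)\<^sup>2) + x z0 ^ 15 / (1 + y z0)\<^sup>2)"
    using xpos[of z0] by (simp add: distrib_left mult_ac)
  finally have curv: "cmod (Q z0) / x z0 ^ 15 * (y z0 / (16 * (1 + x z0)\<^sup>2) + x z0 ^ 15 / (1 + y z0)\<^sup>2) \<le> 16 * r\<^sup>2 / m\<^sup>2"
    by simp
  define T where "T = y z0 / (16 * (1 + x z0)\<^sup>2) + x z0 ^ 15 / (1 + y z0)\<^sup>2"
  have "T \<ge> 0"
    unfolding T_def using xpos[of z0] y(1)[of z0] by auto
  have "W z0 = m ^ 4 * ((1 + x z0) ^ 4 * (1 + y z0)) * (cmod (Q z0) / x z0 ^ 15)\<^sup>2"
    by (simp add: W_def m_def power_divide flip: power_mult)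
  also have "\<dots> \<le> m ^ 4 * (589824 * T\<^sup>2) * (cmod (Q z0) / x z0 ^ 15)\<^sup>2"
    unfolding T_def using y[of z0] xpos[of z0] x8[OF z0R]
    by (intro mult_left_mono mult_right_mono curvature_inequality) auto
  also have "\<dots> = 589824 * m ^ 4 * (cmod (Q z0) / x z0 ^ 15 * T)\<^sup>2"
    unfolding power_mult_distrib[of _ T] by simp
  also have "\<dots> \<le> 589824 * m ^ 4 * (16 * r\<^sup>2 / m\<^sup>2)\<^sup>2"
    using curv \<open>T \<ge> 0\<close> xpos[of z0] unfolding T_def[symmetric]
    by (intro mult_left_mono power_mono) auto
  \<comment> \<open>The factor m^4 of \<open>W\<close> cancels, so the bound does not depend on
    where the maximum lies; 150994944 = 589824 * 16^2.\<close>
  also have "\<dots> = 150994944 * r ^ 4"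
    using mpos by (simp add: power_divide power_mult_distrib flip: power_mult)
  finally have "W 0 \<le> 150994944 * r ^ 4"
    using z0(2)[of 0] r by simp
  moreover have "W 0 = r ^ 4 * (r ^ 4 * ((1 + x 0) ^ 4 * (1 + y 0) * (cmod (Q 0))\<^sup>2 / x 0 ^ 30))"
    by (simp add: W_def flip: power_mult power_add)
  ultimately have "r ^ 4 * (r ^ 4 * ((1 + x 0) ^ 4 * (1 + y 0) * (cmod (Q 0))\<^sup>2 / x 0 ^ 30)) \<le> r ^ 4 * 150994944"
    by linarith
  then have "r ^ 4 * ((1 + x 0) ^ 4 * (1 + y 0) * (cmod (Q 0))\<^sup>2 / x 0 ^ 30) \<le> 150994944"
    by (rule mult_left_le_imp_le) (use r in simp)
  then have *: "r ^ 4 * ((1 + x 0) ^ 4 * (1 + y 0) * (cmod (Q 0))\<^sup>2) \<le> 150994944 * x 0 ^ 30"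
    using xpos[of 0] by (simp add: field_simps)
  define X where "X = cmod (F 0)"
  have "r ^ 4 * (cmod (Q 0))\<^sup>2 * y 0 \<le> r ^ 4 * (cmod (Q 0))\<^sup>2 * ((1 + x 0) ^ 4 * (1 + y 0))"
  proof (intro mult_left_mono)
    have "1 * (1 + y 0) \<le> (1 + x 0) ^ 4 * (1 + y 0)"
      using xpos[of 0] y(1)[of 0] by (intro mult_right_mono one_le_power) auto
    then show "y 0 \<le> (1 + x 0) ^ 4 * (1 + y 0)" by simp
  qed (use r in auto)
  with * have **: "r ^ 4 * (cmod (Q 0))\<^sup>2 * y 0 \<le> 150994944 * x 0 ^ 30"
    by (simp add: mult_ac)
  \<comment> \<open>Of the two factors y in |F'|^4 = |Q|^2 y^2, one is absorbed by the factor 1 + y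
    of the metric and the other is at most 1 + |F 0|.\<close>
  have "(cmod (deriv F 0) * r) ^ 4 = r ^ 4 * ((cmod (deriv F 0))\<^sup>2)\<^sup>2"
    by (simp add: power_mult_distrib flip: power_mult)
  also have "\<dots> = (r ^ 4 * (cmod (Q 0))\<^sup>2 * y 0) * y 0"
    unfolding F'Q[OF 0] by (simp add: power2_eq_square)
  also have "\<dots> \<le> (150994944 * x 0 ^ 30) * (1 + X)"
    by (rule mult_mono[OF **]) (use y[of 0] xpos[of 0] in \<open>auto simp: X_def\<close>)
  also have "\<dots> \<le> (150994944 * (1 + X\<^sup>2)\<^sup>2) * (2 * (1 + X\<^sup>2))"
  proof (rule mult_mono)
    \<comment> \<open>The exponent is raised to 32 because x^32 = |F|^4 fits the spherical
      denominator.\<close>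
    have "x 0 ^ 30 \<le> 1 + x 0 ^ 32"
    proof (cases "x 0 \<le> 1")
      case True
      then have "x 0 ^ 30 \<le> 1" using xpos[of 0] by (intro power_le_one) auto
      then show ?thesis using xpos[of 0] by (simp add: add_increasing2)
    next
      case False
      then have "x 0 ^ 30 \<le> x 0 ^ 32" by (intro power_increasing) auto
      then show ?thesis by simp
    qed
    also have "x 0 ^ 32 = X ^ 4"
      by (simp add: X_def flip: x8[OF 0] power_mult)
    also have "1 + X ^ 4 \<le> (1 + X\<^sup>2)\<^sup>2"
      by (simp add: power2_eq_square algebra_simps power4_eq_xxxx)
    finally show "150994944 * x 0 ^ 30 \<le> 150994944 * (1 + X\<^sup>2)\<^sup>2" by simp
    have "2 * X \<le> X\<^sup>2 + 1"
      using zero_le_power2[of "X - 1"] by (simp add: power2_diff)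
    then show "1 + X \<le> 2 * (1 + X\<^sup>2)"
      using zero_le_power2[of X] by argo
  qed (auto simp: X_def)
  also have "\<dots> = 301989888 * (1 + X\<^sup>2) ^ 3"
    by (simp add: power2_eq_square power3_eq_cube)
  \<comment> \<open>132 is the least integer whose fourth power reaches 301989888 = 2 *
    150994944.\<close>
  also have "\<dots> \<le> 132 ^ 4 * (1 + X\<^sup>2) ^ 4"
    by (intro mult_mono power_increasing) auto
  finally have "(cmod (deriv F 0) * r) ^ 4 \<le> (132 * (1 + X\<^sup>2)) ^ 4"
    by (simp only: power_mult_distrib)
  then show ?thesis
    unfolding X_def by (rule power_le_imp_le_base[of _ 3, simplified]) auto
qed

subsection \<open>Taylor coefficients and separately polynomial functions\<close>

text \<open>The k-th coefficient is the limit, as \<zeta> tends to 0, of \<Phi> minus its lower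
  Taylor terms, divided by \<zeta>^k. The lower terms are holomorphic in \<open>w\<close> by
  induction, and Cauchy estimates make the convergence uniform in \<open>w\<close>.\<close>

lemma holomorphic_taylor_coefficient:
  fixes \<Phi> :: "complex \<Rightarrow> complex \<Rightarrow> complex"
  assumes "open S" "r > 0"
    and hol1: "\<And>\<zeta>. \<zeta> \<in> ball 0 r \<Longrightarrow> \<Phi> \<zeta> holomorphic_on S"
    and hol2: "\<And>w. w \<in> S \<Longrightarrow> (\<lambda>\<zeta>. \<Phi> \<zeta> w) holomorphic_on ball 0 r"
    and bnd: "\<And>\<zeta> w. \<zeta> \<in> ball 0 r \<Longrightarrow> w \<in> S \<Longrightarrow> cmod (\<Phi> \<zeta> w) \<le> M"
  shows "(\<lambda>w. (deriv ^^ k) (\<lambda>\<zeta>. \<Phi> \<zeta> w) 0 / fact k) holomorphic_on S"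
proof (induction k rule: less_induct)
  case (less k)
  define c where "c i w = (deriv ^^ i) (\<lambda>\<zeta>. \<Phi> \<zeta> w) 0 / fact i" for i w
  \<comment> \<open>Cauchy bound for the derivative of order k + 1, from discs of radius r/4 centred
    in the ball of radius r/2.\<close>
  define B where "B = fact (Suc k) * M / (r/4) ^ Suc k"
  have est: "cmod (\<Phi> \<zeta> w - (\<Sum>i\<le>k. c i w * \<zeta> ^ i)) \<le> B * cmod \<zeta> ^ Suc k / fact k"
    if w: "w \<in> S" and \<zeta>: "\<zeta> \<in> ball 0 (r/2)" for \<zeta> w
  proof -
    define g where "g = (\<lambda>\<zeta>. \<Phi> \<zeta> w)"
    have g: "g holomorphic_on ball 0 r"
      unfolding g_def by (rule hol2[OF w])
    have "cmod (g \<zeta> - (\<Sum>i\<le>k. (deriv ^^ i) g 0 * (\<zeta> - 0) ^ i / fact i)) \<le> B * cmod (\<zeta> - 0) ^ Suc k / fact k"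
    proof (rule complex_Taylor[where S = "ball 0 (r/2)" and f = "\<lambda>i. (deriv ^^ i) g" and n = k and w = 0 and z = \<zeta>, simplified funpow_0])
      fix i and x :: complex assume x: "x \<in> ball 0 (r/2)"
      then have x': "x \<in> ball 0 r" using \<open>r > 0\<close> by auto
      have "(deriv ^^ i) g holomorphic_on ball 0 r"
        using g by (intro holomorphic_higher_deriv) auto
      then show "((deriv ^^ i) g has_field_derivative (deriv ^^ Suc i) g x) (at x within ball 0 (r/2))"
        using holomorphic_derivI[OF _ open_ball x'] has_field_derivative_at_within by force
    next
      fix x :: complex assume x: "x \<in> ball 0 (r/2)"
      have sub: "cball x (r/4) \<subseteq> ball 0 r"
      proof
        fix y assume "y \<in> cball x (r/4)"
        then have "cmod y \<le> cmod x + r/4"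
          using norm_triangle_sub[of y x] by (auto simp: dist_norm norm_minus_commute)
        then show "y \<in> ball 0 r" using x \<open>r > 0\<close> by auto
      qed
      show "cmod ((deriv ^^ Suc k) g x) \<le> B"
        unfolding B_def
      proof (rule Cauchy_inequality)
        show "g holomorphic_on ball x (r/4)"
          using g by (rule holomorphic_on_subset) (use sub in auto)
        show "continuous_on (cball x (r/4)) g"
          using g sub by (intro holomorphic_on_imp_continuous_on) (rule holomorphic_on_subset)
        fix y assume "cmod (x - y) = r/4"
        then have "y \<in> ball 0 r" using sub by (auto simp: dist_norm)
        then show "cmod (g y) \<le> M" unfolding g_def using w by (rule bnd)
      qed (use \<open>r > 0\<close> in auto)
    qed (use \<zeta> \<open>r > 0\<close> in auto)
    then show ?thesis
      by (simp add: g_def c_def)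
  qed
  define \<zeta> where "\<zeta> n = complex_of_real (r / 4 / real (Suc n))" for n
  have \<zeta>: "\<zeta> n \<in> ball 0 (r/2)" "\<zeta> n \<noteq> 0" "\<zeta> n \<in> ball 0 r" for n
  proof -
    have "r / 4 / real (Suc n) \<le> r / 4 / 1"
      using \<open>r > 0\<close> by (intro divide_left_mono) auto
    moreover have "cmod (\<zeta> n) = r / 4 / real (Suc n)"
      unfolding \<zeta>_def norm_of_real using \<open>r > 0\<close> by simp
    moreover have "r / 4 / real (Suc n) > 0"
      using \<open>r > 0\<close> by simp
    ultimately have "cmod (\<zeta> n) > 0" "cmod (\<zeta> n) \<le> r / 4"
      by simp_all
    then show "\<zeta> n \<in> ball 0 (r/2)" "\<zeta> n \<noteq> 0" "\<zeta> n \<in> ball 0 r"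
      using \<open>r > 0\<close> by auto
  qed
  have \<zeta>0: "(\<lambda>n. B / fact k * cmod (\<zeta> n)) \<longlonglongrightarrow> 0"
  proof -
    have "(\<lambda>n. r / 4 * inverse (real (Suc n))) \<longlonglongrightarrow> r / 4 * 0"
      by (intro tendsto_intros LIMSEQ_inverse_real_of_nat)
    moreover have "cmod (\<zeta> n) = r / 4 * inverse (real (Suc n))" for n
      using \<open>r > 0\<close> unfolding \<zeta>_def norm_of_real by (simp add: field_simps)
    ultimately have "(\<lambda>n. cmod (\<zeta> n)) \<longlonglongrightarrow> 0"
      by (simp only: mult_zero_right)
    then show ?thesis by (rule tendsto_mult_right_zero)
  qed
  define f where "f n w = (\<Phi> (\<zeta> n) w - (\<Sum>i<k. c i w * \<zeta> n ^ i)) / \<zeta> n ^ k" for n w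
  have hf: "f n holomorphic_on S" for n
  proof -
    have "c i holomorphic_on S" if "i < k" for i
      unfolding c_def[abs_def] by (rule less[OF that])
    then show ?thesis
      unfolding f_def using \<zeta>[of n] hol1 by (intro holomorphic_intros) auto
  qed
  have fc: "cmod (f n w - c k w) \<le> B / fact k * cmod (\<zeta> n)" if "w \<in> S" for n w
  proof -
    have "f n w - c k w = (\<Phi> (\<zeta> n) w - (\<Sum>i\<le>k. c i w * \<zeta> n ^ i)) / \<zeta> n ^ k"
      using \<zeta>(2)[of n] by (simp add: f_def field_simps flip: lessThan_Suc_atMost)
    then have "cmod (f n w - c k w) \<le> (B * cmod (\<zeta> n) ^ Suc k / fact k) / cmod (\<zeta> n) ^ k"
      using divide_right_mono[OF est[OF that \<zeta>(1)[of n]], of "cmod (\<zeta> n) ^ k"]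
      by (simp only: norm_divide norm_power zero_le_power norm_ge_zero)
    also have "\<dots> = B / fact k * cmod (\<zeta> n)"
      using \<zeta>(2)[of n] by simp
    finally show ?thesis .
  qed
  have ul: "uniform_limit S f (c k) sequentially"
  proof (rule uniform_limitI)
    fix e :: real assume "e > 0"
    have "\<forall>\<^sub>F n in sequentially. B / fact k * cmod (\<zeta> n) < e"
      using order_tendstoD(2)[OF \<zeta>0 \<open>e > 0\<close>] .
    then show "\<forall>\<^sub>F n in sequentially. \<forall>x\<in>S. dist (f n x) (c k x) < e"
    proof eventually_elim
      case (elim n)
      then show ?case
        using fc[of _ n] by (auto simp: dist_norm intro: le_less_trans)
    qed
  qed
  have "c k holomorphic_on S"
  proof (rule holomorphic_uniform_sequence[OF \<open>open S\<close> hf])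
    fix x assume "x \<in> S"
    then obtain d where "d > 0" "cball x d \<subseteq> S"
      using \<open>open S\<close> open_contains_cball by blast
    then show "\<exists>d>0. cball x d \<subseteq> S \<and> uniform_limit (cball x d) f (c k) sequentially"
      using uniform_limit_on_subset[OF ul] by blast
  qed
  then show ?case
    by (simp add: c_def[abs_def])
qed

section \<open>Polynomial functions of several variables\<close>

definition monomial :: "('n \<Rightarrow> nat) \<Rightarrow> complex^'n \<Rightarrow> complex" where
  "monomial \<beta> z = (\<Prod>j\<in>UNIV. (z $ j) ^ \<beta> j)"

definition polynomial_fun :: "(complex^'n \<Rightarrow> complex) \<Rightarrow> bool" where
  "polynomial_fun f \<longleftrightarrow> (\<exists>S c. finite S \<and> (\<forall>z. f z = (\<Sum>\<beta>\<in>S. c \<beta> * monomial \<beta> z)))"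

lemma polynomial_fun_const: "polynomial_fun (\<lambda>z. k)"
  unfolding polynomial_fun_def
  by (intro exI[of _ "{\<lambda>_. 0}"] exI[of _ "\<lambda>_. k"]) (simp add: monomial_def)

lemma polynomial_fun_add:
  assumes "polynomial_fun f" "polynomial_fun g"
  shows "polynomial_fun (\<lambda>z. f z + g z)"
proof -
  obtain S c where S: "finite S" "\<And>z. f z = (\<Sum>\<beta>\<in>S. c \<beta> * monomial \<beta> z)"
    using assms(1) unfolding polynomial_fun_def by blast
  obtain T d where T: "finite T" "\<And>z. g z = (\<Sum>\<beta>\<in>T. d \<beta> * monomial \<beta> z)"
    using assms(2) unfolding polynomial_fun_def by blast
  define e where "e \<beta> = (if \<beta> \<in> S then c \<beta> else 0) + (if \<beta> \<in> T then d \<beta> else 0)" for \<beta>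
  have *: "f z + g z = (\<Sum>\<beta>\<in>S \<union> T. e \<beta> * monomial \<beta> z)" for z
  proof -
    have "f z = (\<Sum>\<beta>\<in>S \<union> T. (if \<beta> \<in> S then c \<beta> else 0) * monomial \<beta> z)"
      unfolding S(2) using S(1) T(1) by (intro sum.mono_neutral_cong_left) auto
    moreover have "g z = (\<Sum>\<beta>\<in>S \<union> T. (if \<beta> \<in> T then d \<beta> else 0) * monomial \<beta> z)"
      unfolding T(2) using S(1) T(1) by (intro sum.mono_neutral_cong_left) auto
    ultimately show ?thesis
      by (simp only: e_def distrib_right sum.distrib)
  qed
  then show ?thesis
    unfolding polynomial_fun_def
    by (intro exI[of _ "S \<union> T"] exI[of _ e]) (simp add: * S(1) T(1))
qed

lemma polynomial_fun_sum:
  assumes "\<And>k. k \<in> I \<Longrightarrow> polynomial_fun (f k)"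
  shows "polynomial_fun (\<lambda>z. \<Sum>k\<in>I. f k z)"
  using assms
  by (induction I rule: infinite_finite_induct) (simp_all add: polynomial_fun_const polynomial_fun_add)

lemma monomial_update: "monomial (\<beta>(a := \<beta> a + m)) z = monomial \<beta> z * (z $ a) ^ m"
proof -
  have "(\<Prod>j\<in>UNIV. (z $ j) ^ (\<beta>(a := \<beta> a + m)) j) = (\<Prod>j\<in>UNIV. (z $ j) ^ \<beta> j * (if j = a then (z $ a) ^ m else 1))"
    by (intro prod.cong) (auto simp: power_add)
  then show ?thesis
    by (simp add: monomial_def prod.distrib)
qed

lemma polynomial_fun_mult_coord:
  assumes "polynomial_fun f"
  shows "polynomial_fun (\<lambda>z. f z * (k * (z $ a) ^ m))"
proof -
  obtain S c where S: "finite S" "\<And>z. f z = (\<Sum>\<beta>\<in>S. c \<beta> * monomial \<beta> z)"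
    using assms unfolding polynomial_fun_def by blast
  define h where "h \<beta> = \<beta>(a := \<beta> a + m)" for \<beta> :: "'a \<Rightarrow> nat"
  \<comment> \<open>Left inverse of the shift \<open>h\<close>, carrying coefficients to the shifted
    indices; the truncated subtraction is exact on the image of \<open>h\<close>.\<close>
  define h' where "h' \<beta> = \<beta>(a := \<beta> a - m)" for \<beta> :: "'a \<Rightarrow> nat"
  have h: "h' (h \<beta>) = \<beta>" for \<beta>
    by (auto simp: h_def h'_def)
  then have "inj_on h S" by (metis inj_onI)
  have *: "f z * (k * (z $ a) ^ m) = (\<Sum>\<beta>\<in>h ` S. (k * c (h' \<beta>)) * monomial \<beta> z)" for z
    unfolding S(2) sum.reindex[OF \<open>inj_on h S\<close>] o_def h sum_distrib_right
    by (intro sum.cong) (simp_all add: h_def monomial_update)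
  then show ?thesis
    unfolding polynomial_fun_def
    by (intro exI[of _ "h ` S"] exI[of _ "\<lambda>\<beta>. k * c (h' \<beta>)"]) (simp add: * S(1))
qed

text \<open>Interpolation expresses the coefficients of \<open>w\<close> in a separately polynomial \<open>f\<close> through values of
  \<open>f\<close>, so nothing has to be known about their dependence on the other variables.\<close>

lemma lagrange_interpolation:
  shows "\<exists>l :: nat \<Rightarrow> nat \<Rightarrow> complex. \<forall>c w.
    (\<Sum>i\<le>d. c i * w ^ i) = (\<Sum>k\<le>d. (\<Sum>i\<le>d. c i * of_nat k ^ i) * (\<Sum>m\<le>d. l k m * w ^ m))"
proof -
  \<comment> \<open>The Lagrange basis polynomials for the nodes 0, ..., d.\<close>
  define L :: "nat \<Rightarrow> complex poly" where
    "L k = (\<Prod>j\<in>{..d} - {k}. smult (1 / (of_nat k - of_nat j)) [:- of_nat j, 1:])" for k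
  have degL: "degree (L k) \<le> d" if "k \<le> d" for k
  proof -
    have "degree (L k) \<le> (\<Sum>j\<in>{..d} - {k}. degree (smult (1 / (of_nat k - of_nat j :: complex)) [:- of_nat j, 1:]))"
      unfolding L_def by (rule degree_prod_sum_le[unfolded o_def]) auto
    also have "\<dots> \<le> (\<Sum>j\<in>{..d} - {k}. 1)"
      by (intro sum_mono) auto
    also have "\<dots> = d" using that by simp
    finally show ?thesis .
  qed
  have ev: "poly p w = (\<Sum>m\<le>d. coeff p m * w ^ m)" if "degree p \<le> d" for p :: "complex poly" and w
    unfolding poly_altdef using that by (intro sum.mono_neutral_left) (auto simp: coeff_eq_0)
  have polyL: "poly (L k) (of_nat j) = (if j = k then 1 else 0)" if "k \<le> d" "j \<le> d" for j k
    using that by (auto simp: L_def poly_prod intro!: prod.neutral simp flip: diff_divide_distrib)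
  have "(\<Sum>i\<le>d. c i * w ^ i) = (\<Sum>k\<le>d. (\<Sum>i\<le>d. c i * of_nat k ^ i) * (\<Sum>m\<le>d. coeff (L k) m * w ^ m))"
    for c :: "nat \<Rightarrow> complex" and w
  proof -
    define P where "P = (\<Sum>i\<le>d. monom (c i) i)"
    have P: "poly P x = (\<Sum>i\<le>d. c i * x ^ i)" for x
      by (simp add: P_def poly_sum poly_monom)
    have degP: "degree P \<le> d"
      unfolding P_def by (intro degree_sum_le) (auto intro: order_trans[OF degree_monom_le])
    \<comment> \<open>The interpolation error has degree at most d but d + 1 roots.\<close>
    define E where "E = P - (\<Sum>k\<le>d. smult (poly P (of_nat k)) (L k))"
    have degE: "degree E \<le> d"
      unfolding E_def using degP degL
      by (intro degree_diff_le degree_sum_le) (auto intro: order_trans[OF degree_smult_le])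
    have root: "poly E (of_nat j) = 0" if "j \<le> d" for j
    proof -
      have "(\<Sum>k\<le>d. poly P (of_nat k) * poly (L k) (of_nat j)) = (\<Sum>k\<le>d. if k = j then poly P (of_nat j) else 0)"
        using that by (intro sum.cong) (auto simp: polyL)
      then show ?thesis
        using that by (simp add: E_def poly_sum)
    qed
    have "E = 0"
    proof (rule ccontr)
      assume "E \<noteq> 0"
      have "card (of_nat ` {..d} :: complex set) \<le> card {x. poly E x = 0}"
        by (intro card_mono poly_roots_finite \<open>E \<noteq> 0\<close>) (auto simp: root)
      also have "\<dots> \<le> degree E"
        by (rule card_poly_roots_bound[OF \<open>E \<noteq> 0\<close>])
      finally show False
        using degE by (simp add: card_image inj_on_def)
    qed
    then have "poly P w = poly (\<Sum>k\<le>d. smult (poly P (of_nat k)) (L k)) w"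
      by (simp add: E_def)
    then show ?thesis
      using degL by (simp add: poly_sum P ev)
  qed
  then show ?thesis by (intro exI[of _ "\<lambda>k m. coeff (L k) m"] allI)
qed

text \<open>Coordinates are released one at a time: those in \<open>A\<close> vary, the rest are
  frozen at \<open>y\<close>. Interpolation trades a newly released coordinate for the nodes 0, ...,
  d, which are again frozen values; hence \<open>y\<close> is arbitrary in the induction.\<close>

lemma separately_polynomial:
  fixes f :: "complex^'n \<Rightarrow> complex"
  assumes "\<And>z a. \<exists>c. \<forall>w. f (\<chi> j. if j = a then w else z $ j) = (\<Sum>k\<le>d. c k * w ^ k)"
  shows "polynomial_fun f"
proof -
  obtain l :: "nat \<Rightarrow> nat \<Rightarrow> complex" where l:
    "\<And>c w. (\<Sum>i\<le>d. c i * w ^ i) = (\<Sum>k\<le>d. (\<Sum>i\<le>d. c i * of_nat k ^ i) * (\<Sum>m\<le>d. l k m * w ^ m))"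
    using lagrange_interpolation[of d] by blast
  have interp: "f (\<chi> j. if j = a then w else z $ j) =
      (\<Sum>k\<le>d. f (\<chi> j. if j = a then of_nat k else z $ j) * (\<Sum>m\<le>d. l k m * w ^ m))" for a z w
  proof -
    obtain c where c: "\<And>w. f (\<chi> j. if j = a then w else z $ j) = (\<Sum>k\<le>d. c k * w ^ k)"
      using assms by metis
    show ?thesis unfolding c by (rule l)
  qed
  have "polynomial_fun (\<lambda>z. f (\<chi> j. if j \<in> A then z $ j else y $ j))" if "finite A" for A y
    using that
  proof (induction A arbitrary: y)
    case empty
    then show ?case by (simp add: polynomial_fun_const)
  next
    case (insert a A)
    have eq: "f (\<chi> j. if j \<in> insert a A then z $ j else y $ j) =
        (\<Sum>k\<le>d. \<Sum>m\<le>d. f (\<chi> j. if j \<in> A then z $ j else (\<chi> j. if j = a then of_nat k else y $ j) $ j)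
            * (l k m * (z $ a) ^ m))" for z
    proof -
      have "(\<chi> j. if j \<in> insert a A then z $ j else y $ j) =
          (\<chi> j. if j = a then z $ a else (\<chi> j. if j \<in> A then z $ j else y $ j) $ j)"
        by (simp add: vec_eq_iff)
      moreover have "(\<chi> j. if j = a then of_nat k else (\<chi> j. if j \<in> A then z $ j else y $ j) $ j) =
         (\<chi> j. if j \<in> A then z $ j else (\<chi> j. if j = a then of_nat k else y $ j) $ j)" for k
        using insert.hyps by (auto simp add: vec_eq_iff)
      ultimately show ?thesis
        by (simp only: interp[of a "z $ a"] sum_distrib_left)
    qed
    show ?case
      unfolding eq by (intro polynomial_fun_sum polynomial_fun_mult_coord insert.IH)
  qed
  from this[of UNIV] show ?thesis by simp
qed

lemma monomial_scale: "monomial \<beta> (k *s z) = k ^ sum \<beta> UNIV * monomial \<beta> z"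
  by (simp add: monomial_def power_mult_distrib prod.distrib power_sum)

lemma finite_multi_index: "finite {\<beta> :: 'n::finite \<Rightarrow> nat. sum \<beta> UNIV = i}"
proof (rule finite_subset)
  show "{\<beta>. sum \<beta> UNIV = i} \<subseteq> Pi\<^sub>E UNIV (\<lambda>_::'n. {..i})"
    by (auto simp: PiE_def extensional_def intro: member_le_sum)
qed (auto intro: finite_PiE)

text \<open>Both sides of the scaling law are polynomials in k; comparing their coefficients at k^i
  leaves only the monomials of total degree \<open>i\<close>.\<close>

lemma homogeneous_polynomial_fun:
  fixes f :: "complex^'n \<Rightarrow> complex"
  assumes "polynomial_fun f" and hom: "\<And>k z. f (k *s z) = k ^ i * f z"
  shows "homog_poly i f"
proof -
  obtain S c where S: "finite S" "\<And>z. f z = (\<Sum>\<beta>\<in>S. c \<beta> * monomial \<beta> z)"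
    using assms(1) unfolding polynomial_fun_def by blast
  \<comment> \<open>Inserting \<open>i\<close> makes the set nonempty and keeps degree
    \<open>i\<close> in range even if no monomial attains it.\<close>
  define N where "N = Max (insert i ((\<lambda>\<beta>. sum \<beta> UNIV) ` S))"
  have N: "i \<le> N" "\<And>\<beta>. \<beta> \<in> S \<Longrightarrow> sum \<beta> UNIV \<le> N"
    unfolding N_def using S(1) by (auto intro: Max_ge)
  have "f z = (\<Sum>\<beta>\<in>{\<beta>. sum \<beta> UNIV = i}. (if \<beta> \<in> S then c \<beta> else 0) * monomial \<beta> z)" for z
  proof -
    define g where "g m = (\<Sum>\<beta>\<in>{\<beta>\<in>S. sum \<beta> UNIV = m}. c \<beta> * monomial \<beta> z)" for m
    have "(\<Sum>m\<le>N. g m * k ^ m) = (\<Sum>m\<le>N. (if m = i then f z else 0) * k ^ m)" for k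
    proof -
      have "(\<Sum>m\<le>N. g m * k ^ m) = (\<Sum>m\<le>N. \<Sum>\<beta>\<in>{\<beta>\<in>S. sum \<beta> UNIV = m}. c \<beta> * monomial \<beta> (k *s z))"
        unfolding g_def sum_distrib_right by (intro sum.cong) (auto simp: monomial_scale)
      also have "\<dots> = f (k *s z)"
        unfolding S(2) by (rule sum.group) (use S(1) N in auto)
      also have "\<dots> = (\<Sum>m\<le>N. if m = i then f z * k ^ m else 0)"
        using N(1) by (simp add: hom)
      also have "\<dots> = (\<Sum>m\<le>N. (if m = i then f z else 0) * k ^ m)"
        by (intro sum.cong) auto
      finally show ?thesis .
    qed
    then have "g i = (if i = i then f z else 0)"
      using polyfun_eq_coeffs[of g N "\<lambda>m. if m = i then f z else 0"] N(1) by blast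
    then have "f z = (\<Sum>\<beta>\<in>{\<beta>\<in>S. sum \<beta> UNIV = i}. c \<beta> * monomial \<beta> z)"
      by (simp add: g_def)
    also have "\<dots> = (\<Sum>\<beta>\<in>{\<beta>. sum \<beta> UNIV = i}. (if \<beta> \<in> S then c \<beta> else 0) * monomial \<beta> z)"
      by (intro sum.mono_neutral_cong_left finite_multi_index) auto
    finally show ?thesis .
  qed
  then show ?thesis
    unfolding homog_poly_def monomial_def
    by (intro exI[of _ "\<lambda>\<beta>. if \<beta> \<in> S then c \<beta> else 0"]) blast
qed

subsection \<open>Homogeneous expansions of holomorphic functions\<close>

lemma norm_vector_scalar_mult: "norm (k *s (v :: complex^'n)) = cmod k * norm v"
  by (simp add: norm_vec_def L2_set_def norm_mult power_mult_distrib sum_distrib_left[symmetric]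
      real_sqrt_mult)

lemma holo_on_line_derivative:
  assumes "holo_on f D" "z + \<zeta> *s v \<in> D"
  shows "\<exists>d. ((\<lambda>\<zeta>. f (z + \<zeta> *s v)) has_field_derivative d) (at \<zeta>)"
proof -
  obtain c where c: "(f has_derivative (\<lambda>v. \<Sum>j\<in>UNIV. c $ j * v $ j)) (at (z + \<zeta> *s v))"
    using assms unfolding holo_on_def by blast
  have "linear (\<lambda>h. h *s v)"
    by (intro linearI) (auto simp: vec_eq_iff algebra_simps)
  then have "bounded_linear (\<lambda>h. h *s v)"
    by (simp add: linear_conv_bounded_linear)
  then have "((\<lambda>\<zeta>. z + \<zeta> *s v) has_derivative (\<lambda>h. h *s v)) (at \<zeta>)"
    by (auto intro!: derivative_eq_intros bounded_linear_imp_has_derivative)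
  from has_derivative_compose[OF this c]
  have "((\<lambda>\<zeta>. f (z + \<zeta> *s v)) has_derivative (\<lambda>h. (\<Sum>j\<in>UNIV. c $ j * v $ j) * h)) (at \<zeta>)"
    by (simp add: sum_distrib_left sum_distrib_right mult_ac)
  then show ?thesis
    unfolding has_field_derivative_def by blast
qed

lemma holo_on_line:
  assumes "holo_on f D" "\<And>\<zeta>. \<zeta> \<in> S \<Longrightarrow> z + \<zeta> *s v \<in> D"
  shows "(\<lambda>\<zeta>. f (z + \<zeta> *s v)) holomorphic_on S"
  unfolding holomorphic_on_def field_differentiable_def
  using holo_on_line_derivative[OF assms(1) assms(2)] has_field_derivative_at_within by blast

lemma holo_on_continuous:
  assumes "holo_on f D"
  shows "continuous_on D f"
proof (intro continuous_at_imp_continuous_on ballI)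
  fix z assume "z \<in> D"
  then show "isCont f z"
    using assms has_derivative_continuous unfolding holo_on_def by blast
qed

text \<open>The candidate for P_i(v) in the homogeneous expansion at p. One-variable derivatives
  reduce its study to power series and Cauchy estimates on complex lines.\<close>

definition line_coeff :: "(complex^'n \<Rightarrow> complex) \<Rightarrow> complex^'n \<Rightarrow> nat \<Rightarrow> complex^'n \<Rightarrow> complex" where
  "line_coeff h p i v = (deriv ^^ i) (\<lambda>\<zeta>. h (p + \<zeta> *s v)) 0 / fact i"

lemma line_in_ball:
  assumes "cmod \<zeta> * norm v < R"
  shows "p + \<zeta> *s v \<in> ball p R"
  using assms by (simp add: dist_norm norm_vector_scalar_mult)

lemma open_line: "open {\<zeta>. cmod \<zeta> * norm v < R}"
  by (intro open_Collect_less continuous_intros)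

lemma line_coeff_scale:
  assumes h: "holo_on h (ball p R)" and "R > 0"
  shows "line_coeff h p i (k *s v) = k ^ i * line_coeff h p i v"
proof -
  define T where "T = {\<zeta>. cmod \<zeta> * norm v < R}"
  define S where "S = {\<zeta>. cmod \<zeta> * norm (k *s v) < R}"
  have "(\<lambda>\<zeta>. h (p + \<zeta> *s v)) holomorphic_on T"
    by (rule holo_on_line[OF h]) (auto simp: T_def dist_norm norm_vector_scalar_mult)
  moreover have "open S" "open T"
    unfolding S_def T_def by (rule open_line)+
  ultimately have "(deriv ^^ i) (\<lambda>\<zeta>. h (p + (k * \<zeta>) *s v)) 0 = k ^ i * (deriv ^^ i) (\<lambda>\<zeta>. h (p + \<zeta> *s v)) (k * 0)"
    by (rule higher_deriv_compose_linear)
       (use \<open>R > 0\<close> in \<open>simp_all add: S_def T_def norm_vector_scalar_mult norm_mult mult.assoc mult.left_commute\<close>)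
  then show ?thesis
    by (simp add: line_coeff_def vector_smult_assoc mult.commute)
qed

text \<open>The Taylor series along the line from p through z is evaluated at parameter 1, inside
  its disc of convergence since R / |z - p| > 1.\<close>

lemma line_coeff_sums:
  assumes h: "holo_on h (ball p R)" and z: "z \<in> ball p R"
  shows "(\<lambda>i. line_coeff h p i (z - p)) sums h z"
proof -
  have "R > 0" using z by (metis ball_eq_empty empty_iff not_less)
  \<comment> \<open>For z = p the line degenerates to a point and any radius above 1 serves.\<close>
  define r where "r = (if z = p then 2 else R / norm (z - p))"
  have r: "1 < r" "\<And>\<zeta>. cmod \<zeta> < r \<Longrightarrow> cmod \<zeta> * norm (z - p) < R"
  proof -
    show "1 < r"
      using z by (simp add: r_def dist_norm norm_minus_commute)
    show "cmod \<zeta> * norm (z - p) < R" if "cmod \<zeta> < r" for \<zeta>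
      using that \<open>R > 0\<close> by (cases "z = p") (simp_all add: r_def pos_less_divide_eq)
  qed
  have "(\<lambda>\<zeta>. h (p + \<zeta> *s (z - p))) holomorphic_on ball 0 r"
    by (rule holo_on_line[OF h], rule line_in_ball, rule r(2)) simp
  from holomorphic_power_series[OF this, of 1] r(1) show ?thesis
    by (simp add: line_coeff_def)
qed

text \<open>Cauchy's inequality on the disc of radius R / |v|. The growth |v|^i is what later bounds
  the degree.\<close>

lemma line_coeff_bound:
  assumes h: "holo_on h D" and R: "R > 0" "cball p R \<subseteq> D" and M: "\<And>z. z \<in> cball p R \<Longrightarrow> cmod (h z) \<le> M"
  shows "cmod (line_coeff h p i v) \<le> M / R ^ i * norm v ^ i"
proof (cases "v = 0")
  case True
  have "holo_on h (ball p R)"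
    using h R(2) ball_subset_cball unfolding holo_on_def by blast
  from line_coeff_scale[OF this R(1), of i 0 v]
  have "line_coeff h p i v = 0 ^ i * line_coeff h p i v"
    using True by simp
  moreover have "cmod (h p) \<le> M" using M[of p] R by simp
  ultimately show ?thesis
    using True by (cases i) (auto simp: line_coeff_def)
next
  case False
  define r where "r = R / norm v"
  have r: "r > 0" using False R by (simp add: r_def)
  have in_cball: "p + \<zeta> *s v \<in> cball p R" if "cmod \<zeta> \<le> r" for \<zeta>
    using that False by (simp add: dist_norm norm_vector_scalar_mult r_def field_simps)
  have hol: "(\<lambda>\<zeta>. h (p + \<zeta> *s v)) holomorphic_on cball 0 r"
    by (rule holo_on_line[OF h]) (use in_cball R in auto)
  have "cmod ((deriv ^^ i) (\<lambda>\<zeta>. h (p + \<zeta> *s v)) 0) \<le> fact i * M / r ^ i"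
  proof (rule Cauchy_inequality)
    show "(\<lambda>\<zeta>. h (p + \<zeta> *s v)) holomorphic_on ball 0 r"
      using hol ball_subset_cball by (rule holomorphic_on_subset)
    show "continuous_on (cball 0 r) (\<lambda>\<zeta>. h (p + \<zeta> *s v))"
      using hol by (rule holomorphic_on_imp_continuous_on)
    show "cmod (h (p + x *s v)) \<le> M" if "cmod (0 - x) = r" for x
      by (intro M in_cball) (use that in simp)
  qed (rule r)
  then have "cmod (line_coeff h p i v) \<le> M / r ^ i"
    by (simp add: line_coeff_def norm_divide field_simps)
  also have "\<dots> = M / R ^ i * norm v ^ i"
    by (simp add: r_def power_divide)
  finally show ?thesis .
qed

text \<open>\<open>holomorphic_taylor_coefficient\<close> is applied on each ball of radius
  \<open>B\<close> separately, because the admissible radius in \<zeta> shrinks as \<open>B\<close>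
  grows.\<close>

lemma line_coeff_separately_holomorphic:
  assumes h: "holo_on h D" and R: "R > 0" "cball p R \<subseteq> D" and M: "\<And>z. z \<in> cball p R \<Longrightarrow> cmod (h z) \<le> M"
  shows "(\<lambda>w. line_coeff h p i (y + w *s e)) holomorphic_on UNIV"
proof -
  have *: "(\<lambda>w. line_coeff h p i (y + w *s e)) holomorphic_on ball 0 B" for B
  proof -
    define r where "r = R / (norm y + \<bar>B\<bar> * norm e + 1)"
    have N: "norm y + \<bar>B\<bar> * norm e + 1 > 0"
      by (intro add_nonneg_pos add_nonneg_nonneg mult_nonneg_nonneg) auto
    have r: "r > 0" using R N by (simp add: r_def)
    have in_ball: "p + \<zeta> *s (y + w *s e) \<in> ball p R" if "\<zeta> \<in> ball 0 r" "w \<in> ball 0 B" for \<zeta> w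
    proof (rule line_in_ball)
      have "norm (y + w *s e) \<le> norm y + cmod w * norm e"
        using norm_triangle_ineq[of y "w *s e"] by (simp add: norm_vector_scalar_mult)
      also have "cmod w * norm e \<le> \<bar>B\<bar> * norm e"
        using that(2) by (intro mult_right_mono) auto
      finally have "cmod \<zeta> * norm (y + w *s e) \<le> cmod \<zeta> * (norm y + \<bar>B\<bar> * norm e + 1)"
        by (intro mult_left_mono) auto
      also have "\<dots> < r * (norm y + \<bar>B\<bar> * norm e + 1)"
        using that(1) N by (intro mult_strict_right_mono) auto
      also have "\<dots> = R" using N by (simp add: r_def)
      finally show "cmod \<zeta> * norm (y + w *s e) < R" .
    qed
    have sub: "ball p R \<subseteq> D" using R ball_subset_cball by blast
    show ?thesis
      unfolding line_coeff_def
    proof (rule holomorphic_taylor_coefficient[OF open_ball r])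
      fix \<zeta> :: complex assume \<zeta>: "\<zeta> \<in> ball 0 r"
      have "(\<lambda>w. h ((p + \<zeta> *s y) + w *s (\<zeta> *s e))) holomorphic_on ball 0 B"
      proof (rule holo_on_line[OF h])
        fix w :: complex assume "w \<in> ball 0 B"
        moreover have "(p + \<zeta> *s y) + w *s (\<zeta> *s e) = p + \<zeta> *s (y + w *s e)"
          by (simp add: vec_eq_iff algebra_simps)
        ultimately show "(p + \<zeta> *s y) + w *s (\<zeta> *s e) \<in> D"
          using in_ball[OF \<zeta>] sub by (metis subsetD)
      qed
      moreover have "(p + \<zeta> *s y) + w *s (\<zeta> *s e) = p + \<zeta> *s (y + w *s e)" for w
        by (simp add: vec_eq_iff algebra_simps)
      ultimately show "(\<lambda>w. h (p + \<zeta> *s (y + w *s e))) holomorphic_on ball 0 B"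
        by (simp only:)
    next
      fix w :: complex assume "w \<in> ball 0 B"
      then show "(\<lambda>\<zeta>. h (p + \<zeta> *s (y + w *s e))) holomorphic_on ball 0 r"
        by (intro holo_on_line[OF h]) (use in_ball sub in blast)
    next
      fix \<zeta> w :: complex assume "\<zeta> \<in> ball 0 r" "w \<in> ball 0 B"
      then show "cmod (h (p + \<zeta> *s (y + w *s e))) \<le> M"
        using in_ball ball_subset_cball by (intro M) blast
    qed
  qed
  show ?thesis
    unfolding holomorphic_on_def
  proof
    fix w :: complex
    have "w \<in> ball 0 (cmod w + 1)" by simp
    then show "(\<lambda>w. line_coeff h p i (y + w *s e)) field_differentiable at w"
      by (rule holomorphic_on_imp_differentiable_at[OF * open_ball])
  qed
qed

text \<open>In each coordinate the coefficient is entire and grows at most like |w|^i, so Liouville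
  makes it a polynomial of degree at most i. Separate polynomiality together with homogeneity then
  suffices.\<close>

lemma line_coeff_homog_poly:
  fixes h :: "complex^'n \<Rightarrow> complex"
  assumes h: "holo_on h D" and R: "R > 0" "cball p R \<subseteq> D" and M: "\<And>z. z \<in> cball p R \<Longrightarrow> cmod (h z) \<le> M"
  shows "homog_poly i (line_coeff h p i)"
proof (rule homogeneous_polynomial_fun)
  have "holo_on h (ball p R)"
    using h R(2) ball_subset_cball unfolding holo_on_def by blast
  then show "line_coeff h p i (k *s z) = k ^ i * line_coeff h p i z" for k z
    using R(1) by (rule line_coeff_scale)
  have "cmod (h p) \<le> M" using M[of p] R(1) by simp
  then have Mpos: "M \<ge> 0" using norm_ge_zero[of "h p"] by linarith
  show "polynomial_fun (line_coeff h p i)"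
  proof (rule separately_polynomial)
    fix z :: "complex^'n" and a
    define y where "y = (\<chi> j. if j = a then 0 else z $ j)"
    define F where "F w = line_coeff h p i (y + w *s axis a 1)" for w
    have eq: "(\<chi> j. if j = a then w else z $ j) = y + w *s axis a 1" for w
      by (simp add: vec_eq_iff y_def axis_def)
    have "F holomorphic_on UNIV"
      unfolding F_def using assms by (rule line_coeff_separately_holomorphic)
    moreover have "cmod (F w) \<le> (M / R ^ i * 2 ^ i) * cmod w ^ i" if "norm y \<le> cmod w" for w
    proof -
      have "norm (y + w *s axis a 1) \<le> norm y + cmod w * norm (axis a (1::complex))"
        using norm_triangle_ineq[of y "w *s axis a 1"] by (simp add: norm_vector_scalar_mult)
      also have "\<dots> \<le> 2 * cmod w"
        using that by (simp add: norm_axis_1)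
      finally have "norm (y + w *s axis a 1) ^ i \<le> (2 * cmod w) ^ i"
        by (rule power_mono) simp
      then have "M / R ^ i * norm (y + w *s axis a 1) ^ i \<le> M / R ^ i * (2 * cmod w) ^ i"
        using Mpos R(1) by (intro mult_left_mono) auto
      then show ?thesis
        unfolding F_def using line_coeff_bound[OF assms, of i "y + w *s axis a 1"]
        by (simp add: power_mult_distrib)
    qed
    ultimately have "F w = (\<Sum>k\<le>i. (deriv ^^ k) F 0 / fact k * w ^ k)" for w
      by (rule Liouville_polynomial)
    then show "\<exists>c. \<forall>w. line_coeff h p i (\<chi> j. if j = a then w else z $ j) = (\<Sum>k\<le>i. c k * w ^ k)"
      unfolding eq F_def[symmetric] by (intro exI[of _ "\<lambda>k. (deriv ^^ k) F 0 / fact k"]) simp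
  qed
qed

lemma homog_expansion_exists:
  assumes h: "holo_on h D" and "open D" "p \<in> D"
  shows "homog_expansion h p (line_coeff h p)"
proof -
  obtain R where R: "R > 0" "cball p R \<subseteq> D"
    using assms open_contains_cball by blast
  have "compact (h ` cball p R)"
    using holo_on_continuous[OF h] R(2) by (intro compact_continuous_image) (auto intro: continuous_on_subset)
  then obtain M where M: "\<And>z. z \<in> cball p R \<Longrightarrow> cmod (h z) \<le> M"
    by (meson bounded_iff compact_imp_bounded image_eqI)
  have "holo_on h (ball p R)"
    using h R(2) ball_subset_cball unfolding holo_on_def by blast
  then show ?thesis
    unfolding homog_expansion_def
    using line_coeff_homog_poly[OF h R M] line_coeff_sums R(1) by blast
qed

section \<open>Uniqueness of the expansion and the zero multiplicity\<close>

lemma homog_poly_scale: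
  assumes "homog_poly i P"
  shows "P (k *s v) = k ^ i * P v"
proof -
  obtain c where c: "\<And>z. P z = (\<Sum>\<beta>\<in>{\<beta>. sum \<beta> UNIV = i}. c \<beta> * monomial \<beta> z)"
    using assms unfolding homog_poly_def monomial_def by blast
  show ?thesis
    unfolding c sum_distrib_left by (intro sum.cong) (auto simp: monomial_scale)
qed

text \<open>On each line through p the difference of two expansions is a power series in \<zeta>
  with sum 0 near 0, so its coefficients vanish.\<close>

lemma homog_expansion_unique:
  fixes h :: "complex^'n \<Rightarrow> complex"
  assumes P: "homog_expansion h p P" and Q: "homog_expansion h p Q"
  shows "P = Q"
proof (intro ext)
  fix i and v :: "complex^'n"
  obtain d e where d: "d > 0" "\<And>z. z \<in> ball p d \<Longrightarrow> (\<lambda>i. P i (z - p)) sums h z"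
    and e: "e > 0" "\<And>z. z \<in> ball p e \<Longrightarrow> (\<lambda>i. Q i (z - p)) sums h z"
    using assms unfolding homog_expansion_def by blast
  define r where "r = min d e / (norm v + 1)"
  have v: "norm v + 1 > 0" by (intro add_nonneg_pos) auto
  have r: "r > 0" using d(1) e(1) v by (simp add: r_def)
  define a where "a i = P i v - Q i v" for i
  have a: "(\<lambda>i. a i * (\<zeta> - 0) ^ i) sums 0" if "cmod (\<zeta> - 0) < r" for \<zeta>
  proof -
    have "cmod \<zeta> * norm v \<le> cmod \<zeta> * (norm v + 1)"
      by (intro mult_left_mono) auto
    also have "\<dots> < r * (norm v + 1)"
      using that v by (intro mult_strict_right_mono) auto
    also have "\<dots> = min d e" using v by (simp add: r_def)
    finally have "cmod \<zeta> * norm v < d" "cmod \<zeta> * norm v < e" by auto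
    then have "(\<lambda>i. P i (p + \<zeta> *s v - p)) sums h (p + \<zeta> *s v)" "(\<lambda>i. Q i (p + \<zeta> *s v - p)) sums h (p + \<zeta> *s v)"
      by (intro d(2) e(2) line_in_ball; simp)+
    from sums_diff[OF this] have *: "(\<lambda>i. P i (\<zeta> *s v) - Q i (\<zeta> *s v)) sums 0"
      by simp
    have "P i (\<zeta> *s v) = \<zeta> ^ i * P i v" "Q i (\<zeta> *s v) = \<zeta> ^ i * Q i v" for i
      using assms unfolding homog_expansion_def by (blast intro: homog_poly_scale)+
    with * show ?thesis
      by (simp add: a_def algebra_simps)
  qed
  have "a i = 0" for i
  proof (cases "i = 0")
    case True
    have "(\<lambda>i. a i * 0 ^ i) sums 0" using a[of 0] r by simp
    then show ?thesis using True by simp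
  next
    case False
    show ?thesis
    proof (rule ccontr)
      assume "a i \<noteq> 0"
      show False
      proof (rule powser_0_nonzero[OF r a refl \<open>a i \<noteq> 0\<close>])
        \<comment> \<open>With a nonzero coefficient of positive index, 0 would be an isolated zero
          of the sum, which is identically zero.\<close>
        show "0 < i" using \<open>i \<noteq> 0\<close> by simp
        fix s :: real
        assume s: "0 < s" "\<And>z::complex. z \<in> cball 0 s - {0} \<Longrightarrow> (0::complex) \<noteq> 0"
        have "complex_of_real s \<in> cball 0 s - {0}" using s(1) by simp
        then show False using s(2) by blast
      qed
    qed
  qed
  then show "P i v = Q i v"
    by (metis a_def eq_iff_diff_eq_0)
qed

text \<open>As \<open>zero_mult\<close> is a definite description, its value means nothing unless the homogeneous
  expansion is known to exist.\<close>

lemma zero_mult_ge_2_imp_line_deriv: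
  assumes h: "holo_on h D" and D: "open D" "p \<in> D" and ge: "zero_mult h p \<ge> 2"
  shows "deriv (\<lambda>\<zeta>. h (p + \<zeta> *s v)) 0 = 0"
proof -
  define P where "P = line_coeff h p"
  define m where "m = (if \<forall>i. P i = (\<lambda>_. 0) then \<infinity> else enat (LEAST i. P i \<noteq> (\<lambda>_. 0)))"
  have P: "homog_expansion h p P"
    unfolding P_def using h D by (rule homog_expansion_exists)
  have "zero_mult h p = m"
    unfolding zero_mult_def
  proof (rule the_equality)
    show "\<exists>P. homog_expansion h p P \<and> m = (if \<forall>i. P i = (\<lambda>_. 0) then \<infinity> else enat (LEAST i. P i \<noteq> (\<lambda>_. 0)))"
      using P m_def by blast
  next
    fix m'
    assume "\<exists>P. homog_expansion h p P \<and> m' = (if \<forall>i. P i = (\<lambda>_. 0) then \<infinity> else enat (LEAST i. P i \<noteq> (\<lambda>_. 0)))"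
    then obtain P' where P': "homog_expansion h p P'"
      "m' = (if \<forall>i. P' i = (\<lambda>_. 0) then \<infinity> else enat (LEAST i. P' i \<noteq> (\<lambda>_. 0)))"
      by blast
    from homog_expansion_unique[OF P'(1) P] P'(2) show "m' = m"
      by (simp only: m_def)
  qed
  \<comment> \<open>\<open>P 1\<close> at v is the derivative along v. It vanishes when the least
    index is at least two, and also when the multiplicity is infinite.\<close>
  have "P 1 = (\<lambda>_. 0)"
  proof (rule ccontr)
    assume *: "P 1 \<noteq> (\<lambda>_. 0)"
    then have "(LEAST i. P i \<noteq> (\<lambda>_. 0)) \<le> 1"
      by (rule Least_le)
    then have "m \<le> 1"
      using * unfolding m_def one_enat_def by auto
    with ge \<open>zero_mult h p = m\<close> have "(2::enat) \<le> 1" by (metis order_trans)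
    then show False by (simp add: numeral_eq_enat one_enat_def)
  qed
  from fun_cong[OF this, of v] show ?thesis
    by (simp add: P_def line_coeff_def)
qed

subsection \<open>A Schottky estimate\<close>

text \<open>The trace of the normalised hypotheses on a complex line. Ramification is stated as a
  vanishing derivative, which also admits lines on which the function is constantly 1.\<close>

definition omitting_and_ramified :: "(complex \<Rightarrow> complex) \<Rightarrow> real \<Rightarrow> bool" where
  "omitting_and_ramified g R \<longleftrightarrow> g holomorphic_on ball 0 R \<and>
     (\<forall>z\<in>ball 0 R. g z \<noteq> 0 \<and> (g z = 1 \<longrightarrow> deriv g z = 0))"

text \<open>The disc of radius R/2 about \<zeta> lies in the given one; the bound at its centre with
  r = R/4 yields 528 = 4 * 132.\<close>

lemma ramified_derivative_bound_at:
  assumes g: "omitting_and_ramified g R" and \<zeta>: "cmod \<zeta> < R / 2"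
  shows "cmod (deriv g \<zeta>) \<le> 528 / R * (1 + (cmod (g \<zeta>))\<^sup>2)"
proof -
  have R: "R > 0" using \<zeta> norm_ge_zero[of \<zeta>] by linarith
  have hol: "g holomorphic_on ball 0 R"
    using g by (simp add: omitting_and_ramified_def)
  have sub: "\<zeta> + z \<in> ball 0 R" if "z \<in> ball 0 (R / 2)" for z
    using that \<zeta> norm_triangle_ineq[of \<zeta> z] by simp
  define h where "h z = g (\<zeta> + z)" for z
  have dh: "deriv h z = deriv g (\<zeta> + z)" if "z \<in> ball 0 (R / 2)" for z
  proof (rule DERIV_imp_deriv)
    have "(g has_field_derivative deriv g (\<zeta> + z)) (at (z + \<zeta>))"
      using holomorphic_derivI[OF hol open_ball sub[OF that]] by (simp only: add.commute[of \<zeta>])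
    then have "((\<lambda>z. g (z + \<zeta>)) has_field_derivative deriv g (\<zeta> + z)) (at z)"
      by (rule DERIV_shift[THEN iffD1])
    then show "(h has_field_derivative deriv g (\<zeta> + z)) (at z)"
      by (simp only: h_def[abs_def] add.commute[of \<zeta>])
  qed
  have "cmod (deriv h 0) * (R / 4) \<le> 132 * (1 + (cmod (h 0))\<^sup>2)"
  proof (rule ramified_derivative_bound[of _ "R / 2"])
    have "(\<lambda>z. \<zeta> + z) holomorphic_on ball 0 (R / 2)"
      by (intro holomorphic_on_add holomorphic_on_const holomorphic_on_ident)
    from holomorphic_on_compose_gen[OF this hol] sub
    show "h holomorphic_on ball 0 (R / 2)"
      unfolding h_def o_def by blast
    show "h z \<noteq> 0" if "z \<in> ball 0 (R / 2)" for z
      using g sub[OF that] by (simp add: h_def omitting_and_ramified_def)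
    show "deriv h z = 0" if "z \<in> ball 0 (R / 2)" "h z = 1" for z
      using g sub[OF that(1)] dh[OF that(1)] that(2) by (simp add: h_def omitting_and_ramified_def)
  qed (use R in auto)
  then show ?thesis
    using dh[of 0] R by (simp add: h_def field_simps)
qed

text \<open>Along the segment from 0 to \<zeta> the derivative of arctan |g| is that of |g| divided
  by 1 + |g|^2, hence controlled by the spherical derivative. As g has no zeros, |g| is
  differentiable.\<close>

lemma arctan_norm_lipschitz:
  assumes g: "omitting_and_ramified g R" and \<zeta>: "cmod \<zeta> < R / 2"
  shows "\<bar>arctan (cmod (g \<zeta>)) - arctan (cmod (g 0))\<bar> \<le> 528 / R * cmod \<zeta>"
proof -
  have R: "R > 0" using \<zeta> norm_ge_zero[of \<zeta>] by linarith
  have hol: "g holomorphic_on ball 0 R"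
    using g by (simp add: omitting_and_ramified_def)
  define N where "N t = cmod (g (of_real t * \<zeta>))" for t
  define dN where "dN t = (Re (g (of_real t * \<zeta>)) * Re (\<zeta> * deriv g (of_real t * \<zeta>)) +
      Im (g (of_real t * \<zeta>)) * Im (\<zeta> * deriv g (of_real t * \<zeta>))) / N t" for t
  have bd: "((\<lambda>t. arctan (N t)) has_real_derivative dN t / (1 + (N t)\<^sup>2)) (at t)"
    "\<bar>dN t / (1 + (N t)\<^sup>2)\<bar> \<le> 528 / R * cmod \<zeta>" if t: "t \<in> {0..1}" for t
  proof -
    define z where "z = of_real t * \<zeta>"
    have "cmod z \<le> 1 * cmod \<zeta>"
      unfolding z_def norm_mult using t by (intro mult_right_mono) auto
    then have z: "cmod z < R / 2" "z \<in> ball 0 R"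
      using \<zeta> R by auto
    have nz: "g z \<noteq> 0" using g z(2) by (simp add: omitting_and_ramified_def)
    have Npos: "N t > 0" using nz by (simp add: N_def z_def)
    have N: "N = (\<lambda>t. sqrt ((Re (g (of_real t * \<zeta>)))\<^sup>2 + (Im (g (of_real t * \<zeta>)))\<^sup>2))"
      by (simp add: N_def fun_eq_iff cmod_def)
    have "0 + of_real t * \<zeta> \<in> ball 0 R" using z(2) by (simp add: z_def)
    note d = holomorphic_line_derivative[OF hol open_ball this, simplified]
    have s: "(Re (g z))\<^sup>2 + (Im (g z))\<^sup>2 > 0"
      using nz by (simp add: complex_eq_iff sum_power2_gt_zero_iff)
    have dN: "dN t * N t = Re (g (of_real t * \<zeta>)) * Re (\<zeta> * deriv g (of_real t * \<zeta>)) +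
        Im (g (of_real t * \<zeta>)) * Im (\<zeta> * deriv g (of_real t * \<zeta>))"
      using Npos by (simp add: dN_def)
    have "((\<lambda>t. (Re (g (of_real t * \<zeta>)))\<^sup>2 + (Im (g (of_real t * \<zeta>)))\<^sup>2) has_real_derivative
        2 * (dN t * N t)) (at t)"
      by (rule DERIV_cong[OF DERIV_add[OF DERIV_power[OF d(1), of 2] DERIV_power[OF d(2), of 2]]])
         (unfold dN, simp add: algebra_simps)
    from DERIV_chain2[OF DERIV_real_sqrt[OF s[unfolded z_def]] this]
    have "(N has_real_derivative inverse (N t) / 2 * (2 * (dN t * N t))) (at t)"
      unfolding N .
    then have "(N has_real_derivative dN t) (at t)"
      by (rule DERIV_cong) (use Npos in simp)
    then show "((\<lambda>t. arctan (N t)) has_real_derivative dN t / (1 + (N t)\<^sup>2)) (at t)"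
      by (auto intro!: derivative_eq_intros simp: divide_inverse)
    have "\<bar>Re (g z) * Re (\<zeta> * deriv g z) + Im (g z) * Im (\<zeta> * deriv g z)\<bar> = \<bar>Re (cnj (g z) * (\<zeta> * deriv g z))\<bar>"
      by simp
    also have "\<dots> \<le> cmod (cnj (g z) * (\<zeta> * deriv g z))"
      by (rule abs_Re_le_cmod)
    also have "\<dots> = N t * (cmod \<zeta> * cmod (deriv g z))"
      by (simp add: norm_mult N_def z_def)
    finally have "\<bar>dN t\<bar> \<le> cmod \<zeta> * cmod (deriv g z)"
      using Npos by (simp add: dN_def z_def abs_divide divide_le_eq mult.commute)
    also have "\<dots> \<le> cmod \<zeta> * (528 / R * (1 + (N t)\<^sup>2))"
      using ramified_derivative_bound_at[OF g z(1)]
      by (intro mult_left_mono) (auto simp: N_def z_def)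
    finally have "\<bar>dN t\<bar> \<le> 528 / R * cmod \<zeta> * (1 + (N t)\<^sup>2)"
      by (simp add: mult_ac)
    moreover have pos: "1 + (N t)\<^sup>2 > 0"
      by (intro add_pos_nonneg) auto
    moreover have "\<bar>1 + (N t)\<^sup>2\<bar> = 1 + (N t)\<^sup>2" using pos by simp
    ultimately show "\<bar>dN t / (1 + (N t)\<^sup>2)\<bar> \<le> 528 / R * cmod \<zeta>"
      unfolding abs_divide by (simp only: pos_divide_le_eq)
  qed
  have "norm (arctan (N 1) - arctan (N 0)) \<le> 528 / R * cmod \<zeta> * norm (1 - 0 :: real)"
    by (rule field_differentiable_bound[of "{0..1}" _ "\<lambda>t. dN t / (1 + (N t)\<^sup>2)"])
       (use bd in \<open>auto intro: has_field_derivative_at_within\<close>)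
  then show ?thesis by (simp add: N_def)
qed

text \<open>If \<open>\<bar>g 0\<bar> \<le> 1\<close> then \<open>\<bar>g\<bar> \<le> 2\<close> on the disc, otherwise \<open>\<bar>g\<bar> \<ge> 1/2\<close>, so that \<open>4 g\<close> omits 0 and 1.\<close>

lemma ramified_schottky:
  assumes g: "omitting_and_ramified g R" and R: "R > 0" and M: "cmod (g 0) \<le> M"
    and \<zeta>: "cmod \<zeta> \<le> R / 4224"
  shows "cmod (g \<zeta>) \<le> exp (pi * exp (pi * (14 + 8 * M)))"
proof -
  \<comment> \<open>2112 = 4 * 528 makes the variation at most 1/4. As arctan (1/2) \<le> 1/2 and pi
    > 3, this is less than the distance of arctan 1 = pi/4 from arctan (1/2) and from arctan
    2.\<close>
  have lip: "\<bar>arctan (cmod (g z)) - arctan (cmod (g 0))\<bar> \<le> 1/4" if "cmod z \<le> R / 2112" for z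
  proof -
    have "\<bar>arctan (cmod (g z)) - arctan (cmod (g 0))\<bar> \<le> 528 / R * cmod z"
      using that R by (intro arctan_norm_lipschitz[OF g]) auto
    also have "\<dots> \<le> 528 / R * (R / 2112)"
      using that R by (intro mult_left_mono) auto
    also have "\<dots> = 1/4" using R by simp
    finally show ?thesis .
  qed
  have pi3: "pi > 3" using pi_gt3 .
  have arctan_half_le: "arctan (1/2) \<le> 1/2" by (rule arctan_le_self) simp
  show ?thesis
  proof (cases "cmod (g 0) \<le> 1")
    case True
    then have "arctan (cmod (g 0)) \<le> pi / 4"
      using arctan_one arctan_le_iff by metis
    moreover have "\<bar>arctan (cmod (g \<zeta>)) - arctan (cmod (g 0))\<bar> \<le> 1/4"
      using \<zeta> R by (intro lip) auto
    moreover have "arctan 2 = pi / 2 - arctan (1/2)"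
      using arctan_inverse[of "2::real"] by (simp add: inverse_eq_divide)
    ultimately have "arctan (cmod (g \<zeta>)) \<le> arctan 2"
      using arctan_half_le pi3 by linarith
    then have "cmod (g \<zeta>) \<le> 2"
      by (simp only: arctan_le_iff)
    also have "2 \<le> 1 + pi * exp (pi * (14 + 8 * M))"
    proof -
      have "0 \<le> M" using M norm_ge_zero order_trans by blast
      then have "1 \<le> exp (pi * (14 + 8 * M))" by simp
      then have "1 * 1 \<le> pi * exp (pi * (14 + 8 * M))"
        using pi3 by (intro mult_mono) auto
      then show ?thesis by simp
    qed
    also have "\<dots> \<le> exp (pi * exp (pi * (14 + 8 * M)))"
      by (rule exp_ge_add_one_self)
    finally show ?thesis .
  next
    case False
    \<comment> \<open>Rescaling turns the disc of radius R / 2112 into the unit disc, and the factor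
      4 turns |g| \<ge> 1/2 into |h| \<ge> 2. The radius R / 4224 of the claim becomes 1/2.\<close>
    define h where "h w = 4 * g (of_real (R / 2112) * w)" for w
    have in_disc: "cmod (of_real (R / 2112) * w) \<le> R / 2112" if "w \<in> cball 0 1" for w :: complex
      using that R mult_left_mono[of "cmod w" 1 "R / 2112"] unfolding norm_mult norm_of_real by simp
    have ge: "cmod (h w) \<ge> 2" if "w \<in> cball 0 1" for w :: complex
    proof -
      have "arctan (cmod (g 0)) \<ge> pi / 4"
        unfolding arctan_one[symmetric] arctan_le_iff using False by simp
      then have "arctan (cmod (g (of_real (R / 2112) * w))) \<ge> arctan (1/2)"
        using lip[OF in_disc[OF that]] arctan_half_le pi3 by linarith
      then have "cmod (g (of_real (R / 2112) * w)) \<ge> 1/2"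
        by (simp only: arctan_le_iff)
      then show ?thesis by (simp add: h_def norm_mult)
    qed
    define w where "w = \<zeta> / of_real (R / 2112)"
    have w: "cmod w \<le> 1/2"
      using \<zeta> R by (simp add: w_def norm_divide field_simps)
    \<comment> \<open>The inner exponent is 2 + 8 M + 12 = 14 + 8 M.\<close>
    have "cmod (h w) \<le> exp (pi * exp (pi * (2 + 2 * (4 * M) + 12 * (1/2) / (1 - 1/2))))"
    proof (rule Schottky[of h "4 * M" "1/2" w])
      have sub: "of_real (R / 2112) * w \<in> ball 0 R" if "w \<in> cball 0 1" for w :: complex
        using in_disc[OF that] R by simp
      have hol: "g holomorphic_on ball 0 R"
        using g by (simp add: omitting_and_ramified_def)
      have "(\<lambda>w. of_real (R / 2112) * w) holomorphic_on cball 0 1"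
        by (intro holomorphic_on_mult holomorphic_on_const holomorphic_on_ident)
      from holomorphic_on_compose_gen[OF this hol] sub
      have "(\<lambda>w. g (of_real (R / 2112) * w)) holomorphic_on cball 0 1"
        unfolding o_def by blast
      then show "h holomorphic_on cball 0 1"
        unfolding h_def by (intro holomorphic_on_mult holomorphic_on_const)
      show "cmod (h 0) \<le> 4 * M" using M by (simp add: h_def norm_mult)
      show "\<not> (h z = 0 \<or> h z = 1)" if "z \<in> cball 0 1" for z
        using ge[OF that] by auto
    qed (use w in auto)
    moreover have "cmod (g \<zeta>) \<le> cmod (h w)"
      using R by (simp add: h_def w_def norm_mult)
    ultimately show ?thesis by simp
  qed
qed

text \<open>The ball is fixed before \<open>M\<close>. Radii depending on \<open>M\<close> could
  shrink along a chain of balls, which might then fail to cover \<open>D\<close>.\<close>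

definition locally_schottky :: "(complex^'n) set \<Rightarrow> (complex^'n \<Rightarrow> complex) set \<Rightarrow> bool" where
  "locally_schottky D \<F> \<longleftrightarrow> (\<forall>z\<in>D. \<exists>e>0. ball z e \<subseteq> D \<and>
     (\<forall>M. \<exists>M'. \<forall>f\<in>\<F>. \<forall>w\<in>ball z e. \<forall>w'\<in>ball z e. cmod (f w) \<le> M \<longrightarrow> cmod (f w') \<le> M'))"

text \<open>Two points w, w' of a small ball lie on the line w + \<zeta> (w' - w) at parameters 0
  and 1, and this line stays in \<open>D\<close> for |\<zeta>| < R with R \<ge> 4224. The
  one-variable estimate therefore compares the two values directly.\<close>

lemma ramified_locally_schottky:
  fixes D :: "(complex^'n) set"
  assumes D: "open D" and hol: "\<And>f. f \<in> \<F> \<Longrightarrow> holo_on f D" and "a \<noteq> b"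
    and omit: "\<And>f z. f \<in> \<F> \<Longrightarrow> z \<in> D \<Longrightarrow> f z \<noteq> a"
    and ram: "\<And>f z. f \<in> \<F> \<Longrightarrow> z \<in> D \<Longrightarrow> f z = b \<Longrightarrow> zero_mult (\<lambda>z. f z - b) z \<ge> 2"
  shows "locally_schottky D \<F>"
  unfolding locally_schottky_def
proof
  fix z assume "z \<in> D"
  then obtain e where e: "e > 0" "ball z (2 * e) \<subseteq> D"
    using D open_contains_ball by (metis field_sum_of_halves mult_2 half_gt_zero)
  \<comment> \<open>8448 = 2 * 4224, so two points of the small ball are less than e / 4224
    apart.\<close>
  define \<epsilon> where "\<epsilon> = e / 8448"
  have \<epsilon>: "\<epsilon> > 0" "ball z \<epsilon> \<subseteq> ball z (2 * e)"
    using e(1) by (auto simp: \<epsilon>_def)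
  \<comment> \<open>The bound for (f - a) / (b - a), transported back to f.\<close>
  define B where "B M = cmod a + cmod (b - a) * exp (pi * exp (pi * (14 + 8 * ((M + cmod a) / cmod (b - a)))))" for M
  have "cmod (f w') \<le> B M" if f: "f \<in> \<F>" and w: "w \<in> ball z \<epsilon>" "w' \<in> ball z \<epsilon>" and M: "cmod (f w) \<le> M" for f w w' M
  proof (cases "w = w'")
    \<comment> \<open>The line degenerates here, and what remains is that \<open>B M\<close> is at
      least \<open>M\<close>.\<close>
    case True
    have M0: "M \<ge> 0" using M norm_ge_zero order_trans by blast
    define X where "X = (M + cmod a) / cmod (b - a)"
    have X: "X \<ge> 0" "cmod (b - a) * X = M + cmod a"
      using M0 \<open>a \<noteq> b\<close> by (auto simp: X_def)
    have "X \<le> exp (pi * exp (pi * (14 + 8 * X)))"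
    proof -
      have "X \<le> 1 * (1 + 1 * (14 + 8 * X))" using X(1) by simp
      also have "\<dots> \<le> pi * exp (pi * (14 + 8 * X))"
        using X(1) pi_gt3 by (intro mult_mono order_trans[OF _ exp_ge_add_one_self] add_left_mono) auto
      also have "\<dots> \<le> exp (pi * exp (pi * (14 + 8 * X)))"
        using exp_ge_add_one_self[of "pi * exp (pi * (14 + 8 * X))"] by linarith
      finally show ?thesis .
    qed
    then have "cmod (b - a) * X \<le> cmod (b - a) * exp (pi * exp (pi * (14 + 8 * X)))"
      by (rule mult_left_mono) simp
    then show ?thesis
      using M True X(2) unfolding B_def X_def[symmetric] by (smt (verit) norm_ge_zero)
  next
    case False
    define v where "v = w' - w"
    have v: "norm v > 0" using False by (simp add: v_def)
    have "norm v < 2 * \<epsilon>"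
      using w norm_triangle_ineq4[of "w' - z" "w - z"] by (simp add: v_def dist_norm norm_minus_commute)
    define R where "R = e / norm v"
    have R: "R > 0" "1 \<le> R / 4224"
      using e(1) v \<open>norm v < 2 * \<epsilon>\<close> by (auto simp: R_def \<epsilon>_def field_simps)
    have in_D: "w + \<zeta> *s v \<in> D" if "\<zeta> \<in> ball 0 R" for \<zeta>
    proof -
      have "norm (\<zeta> *s v) < e"
        using that v by (simp add: norm_vector_scalar_mult R_def field_simps)
      moreover have "dist z w < e" using w(1) e(1) by (simp add: \<epsilon>_def)
      ultimately have "dist z (w + \<zeta> *s v) < 2 * e"
        using dist_triangle[of z "w + \<zeta> *s v" w] by (simp add: dist_norm)
      then show ?thesis using e(2) by auto
    qed
    define k where "k \<zeta> = f (w + \<zeta> *s v)" for \<zeta>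
    define g where "g \<zeta> = (k \<zeta> - a) / (b - a)" for \<zeta>
    have k: "k holomorphic_on ball 0 R"
      unfolding k_def by (intro holo_on_line[OF hol[OF f]] in_D)
    have "omitting_and_ramified g R"
      unfolding omitting_and_ramified_def
    proof (intro conjI ballI impI)
      show "g holomorphic_on ball 0 R"
        unfolding g_def using \<open>a \<noteq> b\<close> by (intro holomorphic_intros k) auto
      fix \<zeta> :: complex assume \<zeta>: "\<zeta> \<in> ball 0 R"
      show "g \<zeta> \<noteq> 0"
        using omit[OF f in_D[OF \<zeta>]] \<open>a \<noteq> b\<close> by (simp add: g_def k_def)
      assume "g \<zeta> = 1"
      then have "f (w + \<zeta> *s v) = b"
        using \<open>a \<noteq> b\<close> by (simp add: g_def k_def field_simps)
      with ram[OF f in_D[OF \<zeta>]] have "zero_mult (\<lambda>z. f z - b) (w + \<zeta> *s v) \<ge> 2"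
        by simp
      moreover have "holo_on (\<lambda>z. f z - b) D"
        using hol[OF f] unfolding holo_on_def by (fastforce intro!: derivative_eq_intros)
      ultimately have d0: "deriv (\<lambda>\<xi>. f (w + \<zeta> *s v + \<xi> *s v) - b) 0 = 0"
        using zero_mult_ge_2_imp_line_deriv D in_D[OF \<zeta>] by blast
      have kd: "(k has_field_derivative deriv k \<zeta>) (at (\<zeta> + 0))"
        using holomorphic_derivI[OF k open_ball \<zeta>] by simp
      have "((\<lambda>\<xi>. k (\<zeta> + \<xi>)) has_field_derivative deriv k \<zeta>) (at 0)"
        using kd DERIV_shift[of k "deriv k \<zeta>" 0 \<zeta>] by (simp add: add.commute)
      then have "((\<lambda>\<xi>. k (\<zeta> + \<xi>) - b) has_field_derivative deriv k \<zeta>) (at 0)"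
        by (auto intro!: derivative_eq_intros)
      moreover have "(\<lambda>\<xi>. k (\<zeta> + \<xi>) - b) = (\<lambda>\<xi>. f (w + \<zeta> *s v + \<xi> *s v) - b)"
        by (simp add: k_def vector_sadd_rdistrib add.assoc)
      ultimately have "deriv k \<zeta> = 0"
        using d0 DERIV_imp_deriv by metis
      moreover have "(g has_field_derivative deriv k \<zeta> / (b - a)) (at \<zeta>)"
        unfolding g_def using kd \<open>a \<noteq> b\<close> by (auto intro!: derivative_eq_intros)
      ultimately show "deriv g \<zeta> = 0"
        using DERIV_imp_deriv by fastforce
    qed
    moreover have "cmod (g 0) \<le> (M + cmod a) / cmod (b - a)"
    proof -
      have "cmod (f w - a) \<le> M + cmod a"
        using norm_triangle_ineq4[of "f w" a] M by linarith
      then show ?thesis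
        by (simp add: g_def k_def norm_divide divide_right_mono)
    qed
    ultimately have "cmod (g 1) \<le> exp (pi * exp (pi * (14 + 8 * ((M + cmod a) / cmod (b - a)))))"
      using R by (intro ramified_schottky) auto
    then have "cmod (b - a) * cmod (g 1) \<le> cmod (b - a) * exp (pi * exp (pi * (14 + 8 * ((M + cmod a) / cmod (b - a)))))"
      by (rule mult_left_mono) simp
    moreover have "cmod (b - a) * cmod (g 1) = cmod (f w' - a)"
      using \<open>a \<noteq> b\<close> by (simp add: g_def k_def v_def norm_divide)
    moreover have "cmod (f w') \<le> cmod a + cmod (f w' - a)"
      using norm_triangle_ineq[of a "f w' - a"] by simp
    ultimately show ?thesis
      unfolding B_def by linarith
  qed
  then have "\<forall>M. \<exists>M'. \<forall>f\<in>\<F>. \<forall>w\<in>ball z \<epsilon>. \<forall>w'\<in>ball z \<epsilon>. cmod (f w) \<le> M \<longrightarrow> cmod (f w') \<le> M'"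
    by meson
  then show "\<exists>e>0. ball z e \<subseteq> D \<and>
     (\<forall>M. \<exists>M'. \<forall>f\<in>\<F>. \<forall>w\<in>ball z e. \<forall>w'\<in>ball z e. cmod (f w) \<le> M \<longrightarrow> cmod (f w') \<le> M')"
    using \<epsilon> e(2) by (intro exI[of _ \<epsilon>] conjI) auto
qed

subsection \<open>Normality\<close>

text \<open>On the line from z to w the function lives on a disc of radius R = e / |w - z| \<ge> 2,
  so discs of radius R/4 about points of the unit disc stay inside; Cauchy's inequality on them
  gives the factor 4.\<close>

lemma holo_on_lipschitz_at:
  assumes f: "holo_on f D" and sub: "ball z e \<subseteq> D" and e: "e > 0"
    and M: "\<And>w. w \<in> ball z e \<Longrightarrow> cmod (f w) \<le> M" and w: "dist z w \<le> e / 2"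
  shows "cmod (f z - f w) \<le> 4 * M / e * dist z w"
proof (cases "w = z")
  case True
  then show ?thesis by simp
next
  case False
  define v where "v = w - z"
  define R where "R = e / norm v"
  define g where "g \<zeta> = f (z + \<zeta> *s v)" for \<zeta>
  have v: "norm v > 0" "norm v = dist z w" using False by (auto simp: v_def dist_norm norm_minus_commute)
  have R: "R \<ge> 2" using w v e by (simp add: R_def field_simps)
  have in_ball: "z + \<zeta> *s v \<in> ball z e" if "\<zeta> \<in> ball 0 R" for \<zeta>
    by (rule line_in_ball) (use that v in \<open>simp add: R_def field_simps\<close>)
  have g: "g holomorphic_on ball 0 R"
    unfolding g_def by (rule holo_on_line[OF f]) (use in_ball sub in blast)
  have g': "cmod (deriv g \<zeta>) \<le> 4 * M / R" if \<zeta>: "\<zeta> \<in> cball 0 1" for \<zeta>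
  proof -
    have s: "cball \<zeta> (R / 4) \<subseteq> ball 0 R"
    proof
      fix x assume "x \<in> cball \<zeta> (R / 4)"
      then have "cmod (x - \<zeta>) \<le> R / 4" by (simp add: dist_norm norm_minus_commute)
      then show "x \<in> ball 0 R"
        using \<zeta> R norm_triangle_ineq[of \<zeta> "x - \<zeta>"] by simp
    qed
    have "cmod ((deriv ^^ 1) g \<zeta>) \<le> fact 1 * M / (R / 4) ^ 1"
    proof (rule Cauchy_inequality)
      show "g holomorphic_on ball \<zeta> (R / 4)"
        using g by (rule holomorphic_on_subset) (use s in auto)
      show "continuous_on (cball \<zeta> (R / 4)) g"
        using holomorphic_on_subset[OF g s] by (rule holomorphic_on_imp_continuous_on)
      fix x assume "cmod (\<zeta> - x) = R / 4"
      then have "x \<in> ball 0 R" using s by (auto simp: dist_norm)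
      then show "cmod (g x) \<le> M" unfolding g_def by (intro M in_ball)
    qed (use R in auto)
    then show ?thesis by (simp add: mult.commute)
  qed
  have "cmod (g 0 - g 1) \<le> 4 * M / R * cmod (0 - 1)"
  proof (rule field_differentiable_bound[of "cball 0 1" g "deriv g"])
    fix \<zeta> :: complex assume \<zeta>: "\<zeta> \<in> cball 0 1"
    then have "\<zeta> \<in> ball 0 R" using R by simp
    then show "(g has_field_derivative deriv g \<zeta>) (at \<zeta> within cball 0 1)"
      using holomorphic_derivI[OF g open_ball] has_field_derivative_at_within by blast
  qed (use g' in auto)
  also have "4 * M / R * cmod (0 - 1) = 4 * M / e * dist z w"
    using v e by (simp add: R_def)
  finally show ?thesis by (simp add: g_def v_def)
qed

lemma locally_bounded_imp_bounded_on_compact: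
  assumes "compact K" and loc: "\<And>z. z \<in> K \<Longrightarrow> \<exists>e>0. \<exists>M. \<forall>k. \<forall>w\<in>ball z e. cmod (f k w) \<le> M"
  shows "\<exists>M. \<forall>k. \<forall>z\<in>K. cmod (f k z) \<le> M"
proof -
  obtain e M where eM: "\<And>z. z \<in> K \<Longrightarrow> e z > 0" "\<And>z k w. z \<in> K \<Longrightarrow> w \<in> ball z (e z) \<Longrightarrow> cmod (f k w) \<le> M z"
    using loc by metis
  have "K \<subseteq> (\<Union>z\<in>K. ball z (e z))"
    using eM(1) by force
  then obtain T where T: "T \<subseteq> K" "finite T" "K \<subseteq> (\<Union>z\<in>T. ball z (e z))"
    using compactE_image[OF \<open>compact K\<close>, of K "\<lambda>z. ball z (e z)"] by (metis open_ball)
  have "cmod (f k z) \<le> (\<Sum>t\<in>T. \<bar>M t\<bar>)" if z: "z \<in> K" for k z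
  proof -
    obtain t where t: "t \<in> T" "z \<in> ball t (e t)" using T(3) z by blast
    have "cmod (f k z) \<le> \<bar>M t\<bar>" using eM(2)[of t z k] t T(1) by fastforce
    also have "\<dots> \<le> (\<Sum>t\<in>T. \<bar>M t\<bar>)"
      using t(1) T(2) by (intro member_le_sum) auto
    finally show ?thesis .
  qed
  then show ?thesis by blast
qed

text \<open>Arzela-Ascoli works on each member of a compact exhaustion, with equicontinuity from the
  Lipschitz estimate. A diagonal sequence serves all members, and every compact subset of
  \<open>D\<close> lies in one of them.\<close>

lemma Montel_several_variables:
  fixes D :: "(complex^'n) set" and f :: "nat \<Rightarrow> complex^'n \<Rightarrow> complex"
  assumes D: "open D" and hol: "\<And>k. holo_on (f k) D"
    and loc: "\<And>z. z \<in> D \<Longrightarrow> \<exists>e>0. \<exists>M. \<forall>k. \<forall>w\<in>ball z e. cmod (f k w) \<le> M"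
  obtains g r where "strict_mono (r :: nat \<Rightarrow> nat)"
    "\<And>K. compact K \<Longrightarrow> K \<subseteq> D \<Longrightarrow> uniform_limit K (\<lambda>k. f (r k)) g sequentially"
proof -
  obtain C where C: "\<And>n::nat. compact (C n)" "\<And>n. C n \<subseteq> D" "\<Union>(range C) = D"
    "\<And>K. compact K \<Longrightarrow> K \<subseteq> D \<Longrightarrow> \<exists>N. \<forall>n\<ge>N. K \<subseteq> C n"
    using open_Union_compact_subsets[OF D] by metis
  define P where "P i s \<longleftrightarrow> (\<exists>g. uniform_limit (C i) (\<lambda>k. f (s k)) g sequentially)" for i and s :: "nat \<Rightarrow> nat"
  have sub: "\<exists>k. strict_mono k \<and> P i (s \<circ> k)" for i and s :: "nat \<Rightarrow> nat"
  proof -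
    obtain B where B: "\<And>k z. z \<in> C i \<Longrightarrow> cmod (f k z) \<le> B"
      using locally_bounded_imp_bounded_on_compact[OF C(1)[of i], of f] loc C(2)[of i] by (metis subsetD)
    have B': "cmod (f (s n) x) \<le> B" if "x \<in> C i" for n x
      using B[OF that] .
    have equi: "\<exists>d>0. \<forall>n y. y \<in> C i \<and> norm (x - y) < d \<longrightarrow> norm (f (s n) x - f (s n) y) < \<epsilon>"
      if x: "x \<in> C i" and \<epsilon>: "\<epsilon> > 0" for x \<epsilon>
    proof -
      have "x \<in> D" using x C(2) by blast
      then obtain e0 M where e0: "e0 > 0" "\<And>k w. w \<in> ball x e0 \<Longrightarrow> cmod (f k w) \<le> M"
        using loc by metis
      obtain e1 where e1: "e1 > 0" "ball x e1 \<subseteq> D"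
        using D \<open>x \<in> D\<close> open_contains_ball by metis
      define e where "e = min e0 e1"
      have e: "e > 0" "ball x e \<subseteq> D"
        using e0 e1 by (auto simp: e_def)
      have bound: "cmod (f k w) \<le> \<bar>M\<bar> + 1" if "w \<in> ball x e" for k w
      proof -
        have "cmod (f k w) \<le> M" using that by (intro e0(2)) (simp add: e_def)
        then show ?thesis by linarith
      qed
      \<comment> \<open>The first entry stays in the range of the Lipschitz estimate, the second
        brings that estimate below \<epsilon>; |M| + 1 guards against division by zero.\<close>
      define d where "d = min (e / 2) (\<epsilon> * e / (4 * (\<bar>M\<bar> + 1)))"
      have d: "d > 0" using e(1) \<epsilon> by (simp add: d_def)
      have "norm (f (s n) x - f (s n) y) < \<epsilon>" if "norm (x - y) < d" for n y
      proof -
        have "norm (f (s n) x - f (s n) y) \<le> 4 * (\<bar>M\<bar> + 1) / e * dist x y"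
          by (rule holo_on_lipschitz_at[OF hol e(2,1) bound]) (use that in \<open>simp_all add: d_def dist_norm\<close>)
        also have "\<dots> < 4 * (\<bar>M\<bar> + 1) / e * (\<epsilon> * e / (4 * (\<bar>M\<bar> + 1)))"
          using that e(1) by (intro mult_strict_left_mono) (auto simp: d_def dist_norm)
        also have "\<dots> = \<epsilon>"
          using e(1) by simp
        finally show ?thesis .
      qed
      then show ?thesis using d by blast
    qed
    obtain g k where gk: "strict_mono (k :: nat \<Rightarrow> nat)"
      "\<And>e. 0 < e \<Longrightarrow> \<exists>N. \<forall>n x. n \<ge> N \<and> x \<in> C i \<longrightarrow> norm (f (s (k n)) x - g x) < e"
      using Arzela_Ascoli[OF C(1)[of i], of "\<lambda>n. f (s n)" B, OF B' equi] by metis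
    have "uniform_limit (C i) (\<lambda>n. f ((s \<circ> k) n)) g sequentially"
      unfolding uniform_limit_sequentially_iff dist_norm o_def using gk(2) by meson
    then show ?thesis
      unfolding P_def using gk(1) by blast
  qed
  obtain r where r: "strict_mono (r :: nat \<Rightarrow> nat)" "\<And>i. P i (id \<circ> r)"
  proof (rule subsequence_diagonalization_lemma[of P id, OF sub])
    fix i :: nat and s k1 k2 :: "nat \<Rightarrow> nat" and N
    assume "P i (s \<circ> k1)" and k2: "\<And>j. N \<le> j \<Longrightarrow> \<exists>j'\<ge>j. k2 j = k1 j'"
    then obtain g where g: "\<And>e. e > 0 \<Longrightarrow> \<exists>N. \<forall>n\<ge>N. \<forall>x\<in>C i. dist (f (s (k1 n)) x) (g x) < e"
      unfolding P_def uniform_limit_sequentially_iff by auto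
    have "\<exists>N. \<forall>n\<ge>N. \<forall>x\<in>C i. dist (f (s (k2 n)) x) (g x) < e" if e: "e > 0" for e
    proof -
      obtain N' where N': "\<forall>n\<ge>N'. \<forall>x\<in>C i. dist (f (s (k1 n)) x) (g x) < e"
        using g[OF e] by blast
      have "\<forall>x\<in>C i. dist (f (s (k2 n)) x) (g x) < e" if "n \<ge> max N N'" for n
        using k2[of n] N' that by (metis max.bounded_iff order_trans)
      then show ?thesis by blast
    qed
    then show "P i (s \<circ> k2)"
      unfolding P_def uniform_limit_sequentially_iff by auto
  qed blast
  then obtain G where G: "\<And>i. uniform_limit (C i) (\<lambda>k. f (r k)) (G i) sequentially"
    unfolding P_def by auto metis
  \<comment> \<open>The limits on the different compact sets agree on overlaps, being pointwise
    limits; \<open>lim\<close> glues them.\<close>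
  define g where "g z = lim (\<lambda>k. f (r k) z)" for z
  have "uniform_limit K (\<lambda>k. f (r k)) g sequentially" if K: "compact K" "K \<subseteq> D" for K
  proof -
    obtain N where N: "K \<subseteq> C N" using C(4)[OF K] by blast
    have "uniform_limit (C N) (\<lambda>k. f (r k)) g sequentially"
    proof (rule uniform_limit_cong'[THEN iffD1, OF _ _ G[of N]])
      fix x assume "x \<in> C N"
      then have "(\<lambda>k. f (r k) x) \<longlonglongrightarrow> G N x"
        by (rule tendsto_uniform_limitI[OF G])
      then show "G N x = g x"
        unfolding g_def by (simp add: limI)
    qed simp
    then show ?thesis using N by (rule uniform_limit_on_subset)
  qed
  then show thesis using that r(1) by blast
qed

lemma locally_schottky_imp_normal_family:
  fixes D :: "(complex^'n) set"
  assumes D: "open D" "connected D" "D \<noteq> {}" and hol: "\<And>f. f \<in> \<F> \<Longrightarrow> holo_on f D"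
    and S: "locally_schottky D \<F>"
  shows "normal_family D \<F>"
  unfolding normal_family_def
proof (intro allI impI)
  fix s :: "nat \<Rightarrow> complex^'n \<Rightarrow> complex"
  assume s: "\<forall>k. s k \<in> \<F>"
  define B where "B z e \<longleftrightarrow> (\<forall>M. \<exists>M'. \<forall>k. \<forall>w\<in>ball z e. \<forall>w'\<in>ball z e. cmod (s k w) \<le> M \<longrightarrow> cmod (s k w') \<le> M')" for z e
  have loc: "\<exists>e>0. ball z e \<subseteq> D \<and> B z e" if "z \<in> D" for z
    using S that s unfolding locally_schottky_def B_def by meson
  obtain z0 where z0: "z0 \<in> D" using D(3) by blast
  let ?conv = "\<lambda>r. \<exists>g. \<forall>K. compact K \<and> K \<subseteq> D \<longrightarrow> uniform_limit K (\<lambda>k. s (r k)) g sequentially"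
  let ?inf = "\<lambda>r. \<forall>K. compact K \<and> K \<subseteq> D \<longrightarrow> (\<forall>M. \<forall>\<^sub>F k in sequentially. \<forall>z\<in>K. M \<le> cmod (s (r k) z))"
  show "\<exists>r. strict_mono r \<and> (?conv r \<or> ?inf r)"
  \<comment> \<open>The alternative is decided at one base point and spread over \<open>D\<close> by
    connectedness.\<close>
  proof (cases "\<forall>M. \<forall>\<^sub>F k in sequentially. M \<le> cmod (s k z0)")
    case True
    define Q where "Q z \<longleftrightarrow> (\<forall>M. \<forall>\<^sub>F k in sequentially. M \<le> cmod (s k z))" for z
    \<comment> \<open>The Schottky property read backwards: modulus at most M at some y would bound
      \<open>s k x\<close> by M', which fails for all large k.\<close>
    have unif: "\<forall>\<^sub>F k in sequentially. \<forall>y\<in>ball z e. M \<le> cmod (s k y)"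
      if Qx: "Q x" and x: "x \<in> ball z e" and bd:
        "B z e" for x z e M
    proof -
      obtain M' where M': "\<And>k w. w \<in> ball z e \<Longrightarrow> cmod (s k w) \<le> M \<Longrightarrow> cmod (s k x) \<le> M'"
        using x bd unfolding B_def by blast
      have "\<forall>\<^sub>F k in sequentially. M' + 1 \<le> cmod (s k x)"
        using Qx unfolding Q_def by blast
      then show ?thesis
      proof eventually_elim
        case (elim k)
        then show ?case using M'[of _ k] by force
      qed
    qed
    have Q: "Q z" if "z \<in> D" for z
    proof (rule connected_induction_simple[OF D(2) z0 that])
      show "Q z0" using True by (simp add: Q_def)
      fix a assume "a \<in> D"
      then obtain e where e: "e > 0" "ball a e \<subseteq> D"
        "B a e"
        using loc by meson
      have "Q y" if "x \<in> ball a e" "y \<in> ball a e" "Q x" for x y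
        unfolding Q_def
      proof
        fix M
        show "\<forall>\<^sub>F k in sequentially. M \<le> cmod (s k y)"
          using unif[OF that(3,1) e(3), of M] by eventually_elim (use that in blast)
      qed
      moreover have "openin (top_of_set D) (ball a e)"
        using e(2) by (intro open_subset) auto
      moreover have "a \<in> ball a e" using e(1) by simp
      ultimately show "\<exists>T. openin (top_of_set D) T \<and> a \<in> T \<and> (\<forall>x\<in>T. \<forall>y\<in>T. Q x \<longrightarrow> Q y)"
        by blast
    qed
    have "?inf id"
    proof (intro allI impI)
      fix K :: "(complex^'n) set" and M
      assume K: "compact K \<and> K \<subseteq> D"
      obtain e where e: "\<And>z. z \<in> D \<Longrightarrow> e z > 0" "\<And>z. z \<in> D \<Longrightarrow> B z (e z)"
        using loc by metis
      have "K \<subseteq> (\<Union>z\<in>K. ball z (e z))"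
        using e(1) K by force
      then obtain T where T: "T \<subseteq> K" "finite T" "K \<subseteq> (\<Union>z\<in>T. ball z (e z))"
        using compactE_image[of K K "\<lambda>z. ball z (e z)"] K by (metis open_ball)
      have "\<forall>\<^sub>F k in sequentially. \<forall>z\<in>T. \<forall>y\<in>ball z (e z). M \<le> cmod (s k y)"
      proof (rule eventually_ball_finite[OF T(2)], rule ballI)
        fix z assume "z \<in> T"
        then have z: "z \<in> D" using T(1) K by blast
        show "\<forall>\<^sub>F k in sequentially. \<forall>y\<in>ball z (e z). M \<le> cmod (s k y)"
          by (rule unif[OF Q[OF z] _ e(2)[OF z]]) (use e(1)[OF z] in simp)
      qed
      then show "\<forall>\<^sub>F k in sequentially. \<forall>z\<in>K. M \<le> cmod (s (id k) z)"
        by eventually_elim (use T(3) in auto)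
    qed
    then show ?thesis
      by (intro exI[of _ id]) (auto simp: strict_mono_def)
  next
    case False
    then obtain M0 where "\<not> (\<forall>\<^sub>F k in sequentially. M0 \<le> cmod (s k z0))" by blast
    \<comment> \<open>Failure of divergence at the base point leaves a subsequence bounded
      there.\<close>
    then obtain q where q: "strict_mono (q :: nat \<Rightarrow> nat)" "\<And>k. \<not> M0 \<le> cmod (s (q k) z0)"
      using not_eventually_sequentiallyD by blast
    define Q where "Q z \<longleftrightarrow> (\<exists>M. \<forall>k. cmod (s (q k) z) \<le> M)" for z
    have Q: "Q z" if "z \<in> D" for z
    proof (rule connected_induction_simple[OF D(2) z0 that])
      show "Q z0" unfolding Q_def using q(2) by (meson linear)
      fix a assume "a \<in> D"
      then obtain e where e: "e > 0" "ball a e \<subseteq> D"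
        "B a e"
        using loc by meson
      have "Q y" if "x \<in> ball a e" "y \<in> ball a e" "Q x" for x y
        using that e(3) unfolding Q_def B_def by meson
      moreover have "openin (top_of_set D) (ball a e)"
        using e(2) by (intro open_subset) auto
      moreover have "a \<in> ball a e" using e(1) by simp
      ultimately show "\<exists>T. openin (top_of_set D) T \<and> a \<in> T \<and> (\<forall>x\<in>T. \<forall>y\<in>T. Q x \<longrightarrow> Q y)"
        by blast
    qed
    have "\<exists>e>0. \<exists>M. \<forall>k. \<forall>w\<in>ball z e. cmod (s (q k) w) \<le> M" if z: "z \<in> D" for z
    proof -
      obtain M where M: "\<And>k. cmod (s (q k) z) \<le> M" using Q[OF z] unfolding Q_def by blast
      obtain e where e: "e > 0"
        "B z e"
        using loc[OF z] by meson
      obtain M' where "\<And>k w w'. w \<in> ball z e \<Longrightarrow> w' \<in> ball z e \<Longrightarrow> cmod (s k w) \<le> M \<Longrightarrow> cmod (s k w') \<le> M'"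
        using e(2) unfolding B_def by meson
      moreover have "z \<in> ball z e" using e(1) by simp
      ultimately have "\<forall>k. \<forall>w\<in>ball z e. cmod (s (q k) w) \<le> M'"
        using M by blast
      then show ?thesis using e(1) by blast
    qed
    then obtain g r where r: "strict_mono (r :: nat \<Rightarrow> nat)"
      "\<And>K. compact K \<Longrightarrow> K \<subseteq> D \<Longrightarrow> uniform_limit K (\<lambda>k. s (q (r k))) g sequentially"
      using Montel_several_variables[OF D(1), of "\<lambda>k. s (q k)"] hol s by metis
    have "strict_mono (q \<circ> r)"
      using q(1) r(1) by (rule strict_mono_o)
    moreover have "?conv (q \<circ> r)"
      using r(2) by (intro exI[of _ g]) simp
    ultimately show ?thesis by blast
  qed
qed

theorem theorem8:
  fixes D :: "(complex^'n) set" and \<F> :: "(complex^'n \<Rightarrow> complex) set" and a b :: complex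
  assumes "open D" and "connected D" and "D \<noteq> {}"
    and "\<forall>f\<in>\<F>. holo_on f D"
    and "a \<noteq> b"
    and "\<forall>f\<in>\<F>. \<forall>z\<in>D. f z \<noteq> a"
    and "\<forall>f\<in>\<F>. \<forall>\<alpha>\<in>D. f \<alpha> = b \<longrightarrow> zero_mult (\<lambda>z. f z - b) \<alpha> \<ge> 2"
  shows "normal_family D \<F>"
  using assms
  by (intro locally_schottky_imp_normal_family ramified_locally_schottky[of D \<F> a b]) auto

end
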